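(* Let $k\ge 3$, $m\ge 5$, and let $H\in\mathbb B^m$. Then (i) $\rho(B_2(m-4,1))<\rho(B_2(m-3,0))=\rho(B_3^1(m-2,0,0))$; (ii) if $H\notin\{B_2(m-4,1),B_2(m-3,0),B_3^1(m-2,0,0)\}$, then $\rho(H)<\rho(B_2(m-4,1))$.
   Context: A $k$-graph is a pair $H=(V,E)$ with $V$ a nonempty finite set and $E$ a set of $k$-element subsets of $V$ (edges); a multi-hypergraph allows repeated edges. With $V=\{1,\dots,n\}$, the adjacency tensor $\mathcal A(H)$ is the order-$k$ dimension-$n$ tensor with $\mathcal A_{i_1\cdots i_k}$ equal to the number of edges equal to $\{i_1,\dots,i_k\}$ divided by $(k-1)!$. $\lambda\in\mathbb C$ is an eigenvalue if there is a nonzero $x\in\mathbb C^n$ with $\sum_{i_2,\dots,i_k}\mathcal A_{ii_2\cdots i_k}x_{i_2}\cdots x_{i_k}=\lambda x_i^{k-1}$ for all $i$; $\rho(H)$ is the maximum modulus of the eigenvalues. A path is an alternating sequence $v_0e_1v_1\cdots e_sv_s$ of distinct vertices and edges with $v_{j-1},v_j\in e_j$; $H$ is connected if any two vertices lie on a common path. A connected $k$-graph with $n$ vertices and $m$ edges is bicyclic if $n=m(k-1)-1$. $\mathbb B^m$ is the set of connected bicyclic (simple) $k$-graphs with $m$ edges. Attaching a pendent edge at a vertex $x$ means adding a new edge consisting of $x$ and $k-1$ new vertices. For integers $a,b\ge 0$, $B_2(a,b)$ consists of three edges pairwise intersecting exactly in $\{u,v\}$ (their other vertices lying in no other edge), with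 $a$ pendent edges attached at $u$ and $b$ at $v$. For $a,b,c\ge0$, $B_3^1(a,b,c)$ consists of two edges $e_1,e_2$ with $e_1\cap e_2=\{u,v,w\}$ (their other vertices lying in no other edge), with $a,b,c$ pendent edges attached at $u,v,w$ respectively (for $k=3$ the two edges coincide and $B_3^1$ is a multi-hypergraph). *)

theory Defs
  imports Complex_Main "HOL-Library.Multiset"
begin

text \<open>A multi-hypergraph is a vertex set together with a multiset of edges. An ordinary \<open>k\<close>-graph
  is one in which every edge has multiplicity one.\<close>

type_synonym 'a hgraph = "'a set \<times> 'a set multiset"

abbreviation verts :: "'a hgraph \<Rightarrow> 'a set" where "verts \<equiv> fst"
abbreviation edges :: "'a hgraph \<Rightarrow> 'a set multiset" where "edges \<equiv> snd"

definition multi_kgraph :: "nat \<Rightarrow> 'a hgraph \<Rightarrow> bool" where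
  "multi_kgraph k H \<longleftrightarrow> finite (verts H) \<and> verts H \<noteq> {} \<and>
     (\<forall>e \<in># edges H. e \<subseteq> verts H \<and> card e = k)"

definition kgraph :: "nat \<Rightarrow> 'a hgraph \<Rightarrow> bool" where
  "kgraph k H \<longleftrightarrow> multi_kgraph k H \<and> (\<forall>e. count (edges H) e \<le> 1)"

definition hgraph_iso :: "'a hgraph \<Rightarrow> 'b hgraph \<Rightarrow> bool" where
  "hgraph_iso H G \<longleftrightarrow> (\<exists>f. bij_betw f (verts H) (verts G) \<and>
     image_mset (\<lambda>e. f ` e) (edges H) = edges G)"

text \<open>Tensor entries are indexed by lists of vertices of length \<open>k\<close>, the vertices themselves serving
  as indices in place of \<open>1, \<dots>, n\<close>.\<close>

definition adj_tensor :: "nat \<Rightarrow> 'a hgraph \<Rightarrow> 'a list \<Rightarrow> complex" where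
  "adj_tensor k H is = of_nat (count (edges H) (set is)) / fact (k - 1)"

definition hgraph_eigenvalue :: "nat \<Rightarrow> 'a hgraph \<Rightarrow> complex \<Rightarrow> bool" where
  "hgraph_eigenvalue k H \<mu> \<longleftrightarrow> (\<exists>x :: 'a \<Rightarrow> complex. (\<exists>i \<in> verts H. x i \<noteq> 0) \<and>
     (\<forall>i \<in> verts H.
        (\<Sum>js \<in> {js. set js \<subseteq> verts H \<and> length js = k - 1}.
           adj_tensor k H (i # js) * prod_list (map x js)) = \<mu> * x i ^ (k - 1)))"

definition rho :: "nat \<Rightarrow> 'a hgraph \<Rightarrow> real" where
  "rho k H = (GREATEST r. \<exists>\<mu>. hgraph_eigenvalue k H \<mu> \<and> r = cmod \<mu>)"

text \<open>The condition \<open>mset es \<subseteq># edges H\<close> says that the edges of the path are pairwise distinct members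
  of the edge multiset, parallel copies of an edge being distinct.\<close>

definition hpath :: "'a hgraph \<Rightarrow> 'a list \<Rightarrow> 'a set list \<Rightarrow> bool" where
  "hpath H vs es \<longleftrightarrow> length vs = Suc (length es) \<and>
     set vs \<subseteq> verts H \<and> distinct vs \<and> mset es \<subseteq># edges H \<and>
     (\<forall>j < length es. vs ! j \<in> es ! j \<and> vs ! Suc j \<in> es ! j)"

definition hconnected :: "'a hgraph \<Rightarrow> bool" where
  "hconnected H \<longleftrightarrow> (\<forall>u \<in> verts H. \<forall>v \<in> verts H.
     \<exists>vs es. hpath H vs es \<and> u \<in> set vs \<and> v \<in> set vs)"

text \<open>The equation \<open>n = m (k - 1) - 1\<close> is written additively to avoid truncated subtraction.\<close>

definition bicyclic :: "nat \<Rightarrow> 'a hgraph \<Rightarrow> bool" where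
  "bicyclic k H \<longleftrightarrow> hconnected H \<and> card (verts H) + 1 = size (edges H) * (k - 1)"

definition bicyclic_kgraphs :: "nat \<Rightarrow> nat \<Rightarrow> 'a hgraph set" where
  "bicyclic_kgraphs k m = {H. kgraph k H \<and> bicyclic k H \<and> size (edges H) = m}"

text \<open>The \<open>k - 1\<close> new vertices of a pendent edge are those following the largest present vertex.\<close>

definition attach_pendent :: "nat \<Rightarrow> nat \<Rightarrow> nat hgraph \<Rightarrow> nat hgraph" where
  "attach_pendent k x H =
     (let N = {Max (verts H) <.. Max (verts H) + (k - 1)}
      in (verts H \<union> N, add_mset (insert x N) (edges H)))"

text \<open>Here \<open>u = 0\<close> and \<open>v = 1\<close>.\<close>

definition B2 :: "nat \<Rightarrow> nat \<Rightarrow> nat \<Rightarrow> nat hgraph" where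
  "B2 k a b = (attach_pendent k 1 ^^ b) ((attach_pendent k 0 ^^ a)
     ({0..<3 * k - 4},
      {# {0, 1} \<union> {2..<k}, {0, 1} \<union> {k..<2 * k - 2}, {0, 1} \<union> {2 * k - 2..<3 * k - 4} #}))"

text \<open>Here \<open>u = 0\<close>, \<open>v = 1\<close> and \<open>w = 2\<close>; for \<open>k = 3\<close> the two edges coincide, giving an edge of
  multiplicity two.\<close>

definition B31 :: "nat \<Rightarrow> nat \<Rightarrow> nat \<Rightarrow> nat \<Rightarrow> nat hgraph" where
  "B31 k a b c = (attach_pendent k 2 ^^ c) ((attach_pendent k 1 ^^ b) ((attach_pendent k 0 ^^ a)
     ({0..<2 * k - 3}, {# {0, 1, 2} \<union> {3..<k}, {0, 1, 2} \<union> {k..<2 * k - 3} #})))"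

end

theory Submission
  imports Defs "HOL-Analysis.Analysis" "HOL-Combinatorics.Multiset_Permutations"
begin

text \<open>
  Let \<open>y\<close> be the vector of moduli of an eigenvector for an eigenvalue of largest modulus, and let \<open>u\<close>
  be a vertex where \<open>y\<close> is largest. Replacing, in every edge that avoids \<open>u\<close>, the vertex closest to \<open>u\<close>
  by \<open>u\<close> does not decrease any product of \<open>y\<close> over an edge, and it turns \<open>H\<close> into a star at \<open>u\<close> in
  which the degrees of the other vertices exceed 1 by 2 in total. By the weighted inequality between
  the arithmetic and the geometric mean, positive labels \<open>B v e\<close> with sum at most 1 at every vertex
  and product at least \<open>1 / t\<close> over every edge give \<open>\<rho>\<^sup>k \<le> t\<close>; the labels \<open>1 / deg v\<close> away from \<open>u\<close> show
  \<open>\<rho>\<^sup>k \<le> m + 5\<close>, unless the star is that of \<open>B\<^sub>2(m-3,0)\<close> or \<open>B\<^sub>3\<^sup>1(m-2,0,0)\<close>, for which \<open>\<rho>\<^sup>k = m + 6\<close>.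
  In these two cases a moved edge is put back, or all of them if \<open>H\<close> is some \<open>B\<^sub>2(a,b)\<close>. This lowers the
  bound below \<open>\<rho>(B\<^sub>2(m-4,1))\<^sup>k\<close>, the larger root of \<open>(t - m - 5)(t - 1) = 9\<close>.
\<close>

section \<open>Eigenvalue equations over the edges\<close>

lemma multi_kgraphD:
  assumes "multi_kgraph k H"
  shows "finite (verts H)" "verts H \<noteq> {}"
    and "\<And>e. e \<in># edges H \<Longrightarrow> e \<subseteq> verts H"
    and "\<And>e. e \<in># edges H \<Longrightarrow> card e = k"
    and "\<And>e. e \<in># edges H \<Longrightarrow> finite e"
  using assms unfolding multi_kgraph_def by (blast intro: finite_subset)+

abbreviation edges_at :: "'a hgraph \<Rightarrow> 'a \<Rightarrow> 'a set set" where
  "edges_at H v \<equiv> {e. e \<in># edges H \<and> v \<in> e}"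

abbreviation edges_avoiding :: "'a hgraph \<Rightarrow> 'a \<Rightarrow> 'a set set" where
  "edges_avoiding H v \<equiv> {e. e \<in># edges H \<and> v \<notin> e}"

definition star_sum :: "'a hgraph \<Rightarrow> ('a set \<Rightarrow> 'b::comm_semiring_1) \<Rightarrow> 'a \<Rightarrow> 'b" where
  "star_sum H f v = (\<Sum>e\<in>edges_at H v. of_nat (count (edges H) e) * f e)"

definition link_sum :: "'a hgraph \<Rightarrow> ('a \<Rightarrow> 'b::comm_semiring_1) \<Rightarrow> 'a \<Rightarrow> 'b" where
  "link_sum H x v = star_sum H (\<lambda>e. prod x (e - {v})) v"

lemma star_sum_cong:
  assumes "\<And>e. e \<in># edges H \<Longrightarrow> v \<in> e \<Longrightarrow> f e = g e"
  shows "star_sum H f v = star_sum H g v"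
  unfolding star_sum_def using assms by (intro sum.cong) auto

lemma star_sum_mono:
  fixes f g :: "'a set \<Rightarrow> 'b::linordered_semidom"
  assumes "\<And>e. e \<in># edges H \<Longrightarrow> v \<in> e \<Longrightarrow> f e \<le> g e"
  shows "star_sum H f v \<le> star_sum H g v"
  unfolding star_sum_def using assms by (intro sum_mono mult_left_mono) auto

lemma star_sum_mult_left: "star_sum H (\<lambda>e. c * f e) v = c * star_sum H f v"
  unfolding star_sum_def sum_distrib_left by (intro sum.cong) (auto simp: mult_ac)

lemma star_sum_pos:
  fixes f :: "'a set \<Rightarrow> 'b::linordered_semidom"
  assumes "\<And>e. e \<in># edges H \<Longrightarrow> v \<in> e \<Longrightarrow> f e > 0" "e \<in># edges H" "v \<in> e"
  shows "star_sum H f v > 0"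
  unfolding star_sum_def using assms by (intro sum_pos) auto

lemma sum_star_sum:
  assumes "multi_kgraph k H"
  shows "(\<Sum>v\<in>verts H. star_sum H f v)
    = of_nat k * (\<Sum>e\<in>set_mset (edges H). of_nat (count (edges H) e) * f e)"
proof -
  note multiD = multi_kgraphD[OF assms]
  have "(\<Sum>v\<in>verts H. star_sum H f v)
      = (\<Sum>e\<in>set_mset (edges H). \<Sum>v | v \<in> verts H \<and> v \<in> e. of_nat (count (edges H) e) * f e)"
    unfolding star_sum_def using multiD(1) by (intro sum.swap_restrict) auto
  also have "{v. v \<in> verts H \<and> v \<in> e} = e" if "e \<in># edges H" for e
    using multiD(3)[OF that] by blast
  then have "(\<Sum>e\<in>set_mset (edges H). \<Sum>v | v \<in> verts H \<and> v \<in> e. of_nat (count (edges H) e) * f e)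
      = (\<Sum>e\<in>set_mset (edges H). of_nat k * (of_nat (count (edges H) e) * f e))"
    using multiD(4) by (intro sum.cong) auto
  finally show ?thesis
    by (simp add: sum_distrib_left)
qed

lemma link_sum_cong:
  assumes "multi_kgraph k H" "\<And>v. v \<in> verts H \<Longrightarrow> x v = y v"
  shows "link_sum H x v = link_sum H y v"
  unfolding link_sum_def using multi_kgraphD(3)[OF assms(1)] assms(2)
  by (intro star_sum_cong prod.cong) auto

lemma link_sum_mono:
  fixes x y :: "'a \<Rightarrow> 'b::linordered_semidom"
  assumes "multi_kgraph k H" "\<And>v. v \<in> verts H \<Longrightarrow> 0 \<le> x v \<and> x v \<le> y v"
  shows "link_sum H x v \<le> link_sum H y v"
  unfolding link_sum_def using multi_kgraphD(3)[OF assms(1)] assms(2)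
  by (intro star_sum_mono prod_mono) auto

lemma link_sum_scale:
  assumes "multi_kgraph k H"
  shows "link_sum H (\<lambda>v. c * x v) v = c ^ (k - 1) * link_sum H x v"
  unfolding link_sum_def star_sum_mult_left[symmetric]
  using multi_kgraphD(4,5)[OF assms] by (intro star_sum_cong) (simp add: prod.distrib)

lemma mult_link_sum:
  assumes "multi_kgraph k H"
  shows "x v * link_sum H x v = star_sum H (prod x) v"
  unfolding link_sum_def star_sum_mult_left[symmetric]
  using multi_kgraphD(5)[OF assms] by (intro star_sum_cong) (simp add: prod.remove)

lemma norm_link_sum_le:
  fixes x :: "'a \<Rightarrow> 'b::real_normed_field"
  shows "norm (link_sum H x v) \<le> link_sum H (\<lambda>w. norm (x w)) v"
  unfolding link_sum_def star_sum_def
  by (rule order_trans[OF norm_sum]) (simp add: norm_mult prod_norm)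

lemma link_sum_of_real:
  "link_sum H (\<lambda>w. of_real (x w)) v = (of_real (link_sum H x v) :: 'b::real_normed_field)"
  by (simp add: link_sum_def star_sum_def)

lemma lists_spanning_edge_eq_permutations:
  assumes H: "multi_kgraph k H" and e: "e \<in># edges H" "v \<in> e"
  shows "{vs. length vs = k - 1 \<and> set (v # vs) = e} = permutations_of_set (e - {v})"
proof (intro equalityI subsetI)
  note multiD = multi_kgraphD[OF H]
  have "k \<ge> 1"
    using multiD(4,5)[OF e(1)] e(2) by (auto simp: Suc_le_eq card_gt_0_iff)
  fix vs assume "vs \<in> {vs. length vs = k - 1 \<and> set (v # vs) = e}"
  then have "card (set (v # vs)) = length (v # vs)" "set (v # vs) = e"
    using multiD(4)[OF e(1)] \<open>k \<ge> 1\<close> by auto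
  then have "distinct (v # vs)" "set (v # vs) = e"
    by (blast intro: card_distinct)+
  then show "vs \<in> permutations_of_set (e - {v})"
    by (auto simp: permutations_of_set_def)
next
  fix vs assume "vs \<in> permutations_of_set (e - {v})"
  then have "distinct vs" "set vs = e - {v}"
    by (auto dest: permutations_of_setD)
  moreover have "card (e - {v}) = k - 1"
    using multi_kgraphD(4,5)[OF H e(1)] e(2) by simp
  ultimately show "vs \<in> {vs. length vs = k - 1 \<and> set (v # vs) = e}"
    using e(2) by (auto simp flip: distinct_card)
qed

lemma sum_adj_tensor_spanning_edge:
  assumes H: "multi_kgraph k H" and e: "e \<in># edges H" "v \<in> e"
  shows "(\<Sum>vs | length vs = k - 1 \<and> set (v # vs) = e. adj_tensor k H (v # vs) * prod_list (map x vs))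
    = of_nat (count (edges H) e) * prod x (e - {v})"
proof -
  have "adj_tensor k H (v # vs) * prod_list (map x vs)
      = of_nat (count (edges H) e) / fact (k - 1) * prod x (e - {v})"
    if "vs \<in> permutations_of_set (e - {v})" for vs
  proof -
    have "set vs = e - {v}" "distinct vs"
      using that by (auto dest: permutations_of_setD)
    then show ?thesis
      using e(2) by (simp add: adj_tensor_def insert_absorb prod.distinct_set_conv_list[symmetric])
  qed
  moreover have "card (permutations_of_set (e - {v})) = fact (k - 1)"
    using multi_kgraphD(4,5)[OF H e(1)] e(2) by simp
  ultimately show ?thesis
    unfolding lists_spanning_edge_eq_permutations[OF H e] by simp
qed

lemma tensor_sum_eq_link_sum:
  assumes H: "multi_kgraph k H"
  shows "(\<Sum>vs | set vs \<subseteq> verts H \<and> length vs = k - 1.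
           adj_tensor k H (v # vs) * prod_list (map x vs)) = link_sum H x v"
proof -
  note multiD = multi_kgraphD[OF H]
  define L where "L = {vs. set vs \<subseteq> verts H \<and> length vs = k - 1}"
  define L' where "L' = {vs \<in> L. set (v # vs) \<in># edges H}"
  define entry where "entry vs = adj_tensor k H (v # vs) * prod_list (map x vs)" for vs
  have finL: "finite L"
    unfolding L_def using finite_lists_length_eq[OF multiD(1)] by simp
  have "entry vs = 0" if "set (v # vs) \<notin># edges H" for vs
    using that unfolding entry_def adj_tensor_def by (simp only: not_in_iff) simp
  then have "sum entry L = sum entry L'"
    unfolding L'_def using finL by (intro sum.mono_neutral_right) auto
  also have "\<dots> = (\<Sum>e\<in>edges_at H v. sum entry {vs \<in> L'. set (v # vs) = e})"
    using finL by (intro sum.group[symmetric]) (auto simp: L'_def)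
  also have "\<dots> = star_sum H (\<lambda>e. prod x (e - {v})) v"
    unfolding star_sum_def
  proof (intro sum.cong refl)
    fix e assume "e \<in> edges_at H v"
    then have e: "e \<in># edges H" "v \<in> e" by auto
    have "{vs \<in> L'. set (v # vs) = e} = {vs. length vs = k - 1 \<and> set (v # vs) = e}"
      using multiD(3)[OF e(1)] e(1) by (auto simp: L'_def L_def)
    then show "sum entry {vs \<in> L'. set (v # vs) = e} = of_nat (count (edges H) e) * prod x (e - {v})"
      unfolding entry_def by (simp only: sum_adj_tensor_spanning_edge[OF H e])
  qed
  finally show ?thesis
    by (simp add: L_def entry_def link_sum_def)
qed

lemma hgraph_eigenvalue_iff:
  assumes "multi_kgraph k H"
  shows "hgraph_eigenvalue k H \<mu> \<longleftrightarrow>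
    (\<exists>x. (\<exists>v\<in>verts H. x v \<noteq> 0) \<and> (\<forall>v\<in>verts H. link_sum H x v = \<mu> * x v ^ (k - 1)))"
  unfolding hgraph_eigenvalue_def tensor_sum_eq_link_sum[OF assms] ..

section \<open>Attainment of the spectral radius\<close>

lemma finite_nonempty_obtains_maximizer:
  fixes f :: "'a \<Rightarrow> 'b::linorder"
  assumes "finite A" "A \<noteq> {}"
  obtains u where "u \<in> A" "\<And>v. v \<in> A \<Longrightarrow> f v \<le> f u"
  using assms obtains_MAX[OF assms, of f] by (metis Max_ge finite_imageI imageI)

lemma eigenvalue_iff_normalized:
  assumes H: "multi_kgraph k H"
  shows "hgraph_eigenvalue k H \<mu> \<longleftrightarrow>
    (\<exists>u\<in>verts H. \<exists>x. x u = 1 \<and> (\<forall>v\<in>verts H. norm (x v) \<le> 1) \<and> (\<forall>v. v \<notin> verts H \<longrightarrow> x v = 0) \<and>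
      (\<forall>v\<in>verts H. link_sum H x v = \<mu> * x v ^ (k - 1)))" (is "_ \<longleftrightarrow> ?normalized")
proof
  note multiD = multi_kgraphD[OF H]
  assume "hgraph_eigenvalue k H \<mu>"
  then obtain x where nonzero: "\<exists>v\<in>verts H. x v \<noteq> 0"
    and eigen: "\<And>v. v \<in> verts H \<Longrightarrow> link_sum H x v = \<mu> * x v ^ (k - 1)"
    using hgraph_eigenvalue_iff[OF H] by auto
  obtain u where u: "u \<in> verts H" and max: "\<And>v. v \<in> verts H \<Longrightarrow> norm (x v) \<le> norm (x u)"
    using finite_nonempty_obtains_maximizer[OF multiD(1,2), of "\<lambda>v. norm (x v)"] by blast
  have xu: "x u \<noteq> 0"
    using nonzero max by fastforce
  define z where "z v = (if v \<in> verts H then x v / x u else 0)" for v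
  have "link_sum H z v = \<mu> * z v ^ (k - 1)" if "v \<in> verts H" for v
  proof -
    have "link_sum H z v = link_sum H (\<lambda>w. inverse (x u) * x w) v"
      by (rule link_sum_cong[OF H]) (simp add: z_def field_simps)
    also have "\<dots> = inverse (x u) ^ (k - 1) * (\<mu> * x v ^ (k - 1))"
      by (simp add: link_sum_scale[OF H] eigen that)
    finally show ?thesis
      using that by (simp add: z_def divide_inverse power_mult_distrib mult_ac)
  qed
  then show ?normalized
    using u xu max by (intro bexI[of _ u] exI[of _ z]) (auto simp: z_def norm_divide divide_le_eq_1)
next
  assume ?normalized
  then show "hgraph_eigenvalue k H \<mu>"
    unfolding hgraph_eigenvalue_iff[OF H] by (metis zero_neq_one)
qed

lemma continuous_on_link_sum:
  fixes S :: "('a \<Rightarrow> 'b::real_normed_field) set"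
  shows "continuous_on S (\<lambda>x. link_sum H x v)"
  unfolding link_sum_def star_sum_def
  by (intro continuous_intros continuous_on_subset[OF continuous_on_product_coordinates]) auto

lemma compact_unit_polydisc:
  fixes A :: "'a set"
  shows "compact {x :: 'a \<Rightarrow> complex. (\<forall>i\<in>A. norm (x i) \<le> 1) \<and> (\<forall>i. i \<notin> A \<longrightarrow> x i = 0)}"
proof -
  have "{x :: 'a \<Rightarrow> complex. (\<forall>i\<in>A. norm (x i) \<le> 1) \<and> (\<forall>i. i \<notin> A \<longrightarrow> x i = 0)}
      = PiE UNIV (\<lambda>i. if i \<in> A then cball 0 1 else {0})"
    by (auto simp: PiE_def Pi_def)
  moreover have "compactin (product_topology (\<lambda>i. euclidean) UNIV)
      (PiE UNIV (\<lambda>i :: 'a. if i \<in> A then cball 0 1 else {0 :: complex}))"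
    unfolding compactin_PiE by auto
  ultimately show ?thesis
    by (simp add: euclidean_product_topology)
qed

lemma compact_eigenvalues:
  assumes H: "multi_kgraph k H"
  shows "compact {\<mu>. hgraph_eigenvalue k H \<mu>}"
proof -
  define K where "K u = {x :: 'a \<Rightarrow> complex. (\<forall>v\<in>verts H. norm (x v) \<le> 1) \<and> (\<forall>v. v \<notin> verts H \<longrightarrow> x v = 0)}
    \<inter> {x. x u = 1} \<inter> (\<Inter>v\<in>verts H. {x. link_sum H x v = link_sum H x u * x v ^ (k - 1)})" for u
  have "compact (K u)" for u
    unfolding K_def
    by (intro compact_Int_closed compact_unit_polydisc closed_INT ballI closed_Collect_eq
        continuous_on_link_sum continuous_intros) auto
  then have "compact (\<Union>u\<in>verts H. (\<lambda>x. link_sum H x u) ` K u)"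
    using multi_kgraphD(1)[OF H] by (intro compact_UN compact_continuous_image continuous_on_link_sum)
  moreover have "hgraph_eigenvalue k H \<mu> \<longleftrightarrow> \<mu> \<in> (\<Union>u\<in>verts H. (\<lambda>x. link_sum H x u) ` K u)" for \<mu>
  proof -
    \<comment> \<open>At the entry 1 of a normalized eigenvector the link sum is the eigenvalue.\<close>
    have "x u = 1 \<and> (\<forall>v\<in>verts H. norm (x v) \<le> 1) \<and> (\<forall>v. v \<notin> verts H \<longrightarrow> x v = 0) \<and>
        (\<forall>v\<in>verts H. link_sum H x v = \<mu> * x v ^ (k - 1)) \<longleftrightarrow> x \<in> K u \<and> \<mu> = link_sum H x u"
      if "u \<in> verts H" for x u
      using that by (auto simp: K_def)
    then show ?thesis
      unfolding eigenvalue_iff_normalized[OF H] by (auto simp: image_iff)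
  qed
  then have "{\<mu>. hgraph_eigenvalue k H \<mu>} = (\<Union>u\<in>verts H. (\<lambda>x. link_sum H x u) ` K u)"
    by blast
  ultimately show ?thesis
    by simp
qed

lemma zero_eigenvalue:
  assumes H: "multi_kgraph k H" and k: "k \<ge> 3"
  shows "hgraph_eigenvalue k H 0"
proof -
  note multiD = multi_kgraphD[OF H]
  obtain u where u: "u \<in> verts H" using multiD(2) by auto
  define x :: "'a \<Rightarrow> complex" where "x v = (if v = u then 1 else 0)" for v
  have "prod x (e - {v}) = 0" if e: "e \<in># edges H" for e v
  proof -
    have "card {v, u} < card e"
      using multiD(4)[OF e] k by (simp add: card_insert_if)
    then have "\<not> e \<subseteq> {v, u}"
      using card_mono[of "{v, u}" e] by auto
    then show ?thesis
      using multiD(5)[OF e] by (auto simp: x_def intro!: prod_zero)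
  qed
  then have "link_sum H x v = 0" for v
    by (simp add: link_sum_def star_sum_def)
  then show ?thesis
    unfolding hgraph_eigenvalue_iff[OF H] using u k by (auto simp: x_def intro!: exI[of _ x] bexI[of _ u])
qed

lemma rho_attained:
  assumes H: "multi_kgraph k H" and k: "k \<ge> 3"
  obtains \<mu> where "hgraph_eigenvalue k H \<mu>" "rho k H = cmod \<mu>"
proof -
  have "compact (cmod ` {\<mu>. hgraph_eigenvalue k H \<mu>})"
    using H by (intro compact_continuous_image compact_eigenvalues continuous_intros)
  moreover have "cmod ` {\<mu>. hgraph_eigenvalue k H \<mu>} \<noteq> {}"
    using zero_eigenvalue[OF H k] by auto
  ultimately obtain r where r: "r \<in> cmod ` {\<mu>. hgraph_eigenvalue k H \<mu>}"
    "\<forall>s\<in>cmod ` {\<mu>. hgraph_eigenvalue k H \<mu>}. s \<le> r"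
    using compact_attains_sup by metis
  then have "rho k H = r"
    unfolding rho_def by (intro Greatest_equality) auto
  with r(1) that show ?thesis
    by auto
qed

section \<open>Positive eigenvectors\<close>

text \<open>The Collatz--Wielandt bound: compare the eigenvector with \<open>x\<close> at a vertex where the ratio of
  their entries is largest.\<close>

lemma cmod_eigenvalue_le:
  fixes x :: "'a \<Rightarrow> real"
  assumes H: "multi_kgraph k H" and ev: "hgraph_eigenvalue k H \<mu>"
    and x_pos: "\<And>v. v \<in> verts H \<Longrightarrow> x v > 0"
    and super: "\<And>v. v \<in> verts H \<Longrightarrow> link_sum H x v \<le> r * x v ^ (k - 1)"
  shows "cmod \<mu> \<le> r"
proof -
  note multiD = multi_kgraphD[OF H]
  obtain z where nonzero: "\<exists>v\<in>verts H. z v \<noteq> 0"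
    and eigen: "\<And>v. v \<in> verts H \<Longrightarrow> link_sum H z v = \<mu> * z v ^ (k - 1)"
    using ev hgraph_eigenvalue_iff[OF H] by auto
  obtain u where u: "u \<in> verts H" and max: "\<And>v. v \<in> verts H \<Longrightarrow> cmod (z v) / x v \<le> cmod (z u) / x u"
    using finite_nonempty_obtains_maximizer[OF multiD(1,2), of "\<lambda>v. cmod (z v) / x v"] by blast
  define c where "c = cmod (z u) / x u"
  have le: "cmod (z v) \<le> c * x v" if "v \<in> verts H" for v
    using max[OF that] x_pos[OF that] by (simp add: c_def pos_divide_le_eq)
  have c_pos: "c > 0"
    using nonzero le x_pos by (metis mult_nonpos_nonneg norm_le_zero_iff not_le order_trans less_imp_le)
  have zu: "cmod (z u) = c * x u"
    using x_pos[OF u] by (simp add: c_def)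
  have "cmod \<mu> * (c * x u) ^ (k - 1) = cmod (link_sum H z u)"
    by (simp add: eigen[OF u] norm_mult norm_power zu)
  also have "\<dots> \<le> link_sum H (\<lambda>v. cmod (z v)) u"
    by (rule norm_link_sum_le)
  also have "\<dots> \<le> link_sum H (\<lambda>v. c * x v) u"
    by (rule link_sum_mono[OF H]) (simp add: le)
  also have "\<dots> \<le> c ^ (k - 1) * (r * x u ^ (k - 1))"
    using super[OF u] c_pos by (simp add: link_sum_scale[OF H])
  also have "\<dots> = r * (c * x u) ^ (k - 1)"
    by (simp add: power_mult_distrib)
  finally show ?thesis
    using c_pos x_pos[OF u] by simp
qed

lemma rho_eq_positive_eigenvector:
  fixes x :: "'a \<Rightarrow> real"
  assumes H: "multi_kgraph k H" and r: "r \<ge> 0"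
    and x_pos: "\<And>v. v \<in> verts H \<Longrightarrow> x v > 0"
    and eigen: "\<And>v. v \<in> verts H \<Longrightarrow> link_sum H x v = r * x v ^ (k - 1)"
  shows "rho k H = r"
  unfolding rho_def
proof (rule Greatest_equality)
  have "\<exists>v\<in>verts H. complex_of_real (x v) \<noteq> 0"
    using multi_kgraphD(2)[OF H] x_pos by fastforce
  moreover have "\<forall>v\<in>verts H. link_sum H (\<lambda>w. complex_of_real (x w)) v
      = complex_of_real r * complex_of_real (x v) ^ (k - 1)"
    by (simp add: link_sum_of_real eigen)
  ultimately have "hgraph_eigenvalue k H (of_real r)"
    unfolding hgraph_eigenvalue_iff[OF H] by (intro exI[of _ "\<lambda>w. complex_of_real (x w)"] conjI)
  then show "\<exists>\<mu>. hgraph_eigenvalue k H \<mu> \<and> r = cmod \<mu>"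
    using r by (intro exI[of _ "of_real r"]) simp
next
  fix s assume "\<exists>\<mu>. hgraph_eigenvalue k H \<mu> \<and> s = cmod \<mu>"
  then show "s \<le> r"
    using cmod_eigenvalue_le[OF H _ x_pos eq_refl[OF eigen]] by blast
qed

lemma real_root_prod:
  assumes "n > 0"
  shows "root n (prod f A) = (\<Prod>a\<in>A. root n (f a))"
  using assms by (induction A rule: infinite_finite_induct) (auto simp: real_root_mult)

text \<open>Up to a constant factor, \<open>f e\<close> is the product over \<open>e\<close> of the entries of a positive eigenvector,
  whose \<open>k\<close>-th powers are then the sums \<open>star_sum H f v\<close>.\<close>

lemma rho_eq_root:
  fixes f :: "'a set \<Rightarrow> real"
  assumes H: "multi_kgraph k H" and k: "k \<ge> 1" and t: "t > 0"
    and f_pos: "\<And>e. e \<in># edges H \<Longrightarrow> f e > 0"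
    and cover: "verts H \<subseteq> \<Union>(set_mset (edges H))"
    and prod_eq: "\<And>e. e \<in># edges H \<Longrightarrow> prod (star_sum H f) e = t * f e ^ k"
  shows "rho k H = root k t"
proof (rule rho_eq_positive_eigenvector[OF H])
  define x where "x v = root k (star_sum H f v)" for v
  have k0: "k > 0" using k by simp
  then show "root k t \<ge> 0" using t by simp
  have S_pos: "star_sum H f v > 0" if v: "v \<in> verts H" for v
  proof -
    obtain e where "e \<in># edges H" "v \<in> e" using v cover by blast
    then show ?thesis using f_pos by (intro star_sum_pos) auto
  qed
  show x_pos: "x v > 0" if "v \<in> verts H" for v
    using k0 S_pos[OF that] by (simp add: x_def)
  have prod_x: "prod x e = root k t * f e" if e: "e \<in># edges H" for e
  proof -
    have "prod x e = root k (prod (star_sum H f) e)"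
      using k0 by (simp add: x_def real_root_prod)
    also have "\<dots> = root k t * f e"
      using k0 f_pos[OF e] by (simp add: prod_eq[OF e] real_root_mult real_root_power_cancel)
    finally show ?thesis .
  qed
  show "link_sum H x v = root k t * x v ^ (k - 1)" if v: "v \<in> verts H" for v
  proof -
    have "x v * link_sum H x v = star_sum H (\<lambda>e. root k t * f e) v"
      unfolding mult_link_sum[OF H] by (intro star_sum_cong prod_x)
    also have "\<dots> = root k t * x v ^ k"
      using k0 S_pos[OF v] by (simp add: star_sum_mult_left x_def)
    also have "\<dots> = x v * (root k t * x v ^ (k - 1))"
      using k0 by (simp add: power_eq_if)
    finally show ?thesis
      using x_pos[OF v] by simp
  qed
qed

section \<open>Edge labellings\<close>

lemma weighted_arith_geom_mean:
  fixes y B :: "'a \<Rightarrow> real"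
  assumes e: "card e = k" "k > 0" and y: "\<And>v. v \<in> e \<Longrightarrow> y v \<ge> 0"
    and B: "\<And>v. v \<in> e \<Longrightarrow> B v > 0" and t: "t * prod B e \<ge> 1" "t > 0"
  shows "real k * prod y e \<le> root k t * (\<Sum>v\<in>e. B v * y v ^ k)"
proof -
  have fin: "finite e" "e \<noteq> {}"
    using e card_gt_0_iff[of e] by auto
  have term_nonneg: "B v * y v ^ k \<ge> 0" if "v \<in> e" for v
    using y[OF that] B[OF that] by simp
  have prod_nonneg: "(\<Prod>v\<in>e. B v * y v ^ k) \<ge> 0" "prod y e \<ge> 0"
    using y term_nonneg by (auto intro: prod_nonneg)
  have "root k (\<Prod>v\<in>e. B v * y v ^ k) = (\<Prod>v\<in>e. B v * y v ^ k) powr (1 / card e)"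
    using prod_nonneg e by (cases "(\<Prod>v\<in>e. B v * y v ^ k) = 0") (auto simp: root_powr_inverse)
  also have "\<dots> \<le> (\<Sum>v\<in>e. B v * y v ^ k / card e)"
    using arith_geom_mean[OF fin term_nonneg] by simp
  finally have amgm: "real k * root k (\<Prod>v\<in>e. B v * y v ^ k) \<le> (\<Sum>v\<in>e. B v * y v ^ k)"
    using e by (simp add: field_simps flip: sum_divide_distrib)
  have "prod y e = root k (prod y e ^ k)"
    using prod_nonneg e by (simp add: real_root_power_cancel)
  also have "\<dots> \<le> root k (t * prod B e * prod y e ^ k)"
    using e t prod_nonneg mult_right_mono[OF t(1), of "prod y e ^ k"] by simp
  also have "t * prod B e * prod y e ^ k = t * (\<Prod>v\<in>e. B v * y v ^ k)"
    by (simp add: prod.distrib prod_power_distrib)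
  also have "root k \<dots> = root k t * root k (\<Prod>v\<in>e. B v * y v ^ k)"
    by (simp add: real_root_mult)
  finally have "real k * prod y e \<le> root k t * (real k * root k (\<Prod>v\<in>e. B v * y v ^ k))"
    using e by simp
  also have "\<dots> \<le> root k t * (\<Sum>v\<in>e. B v * y v ^ k)"
    using amgm t e by (intro mult_left_mono) auto
  finally show ?thesis .
qed

locale edge_family =
  fixes k :: nat and V :: "'a set" and E :: "'e set" and \<phi> :: "'e \<Rightarrow> 'a set"
  assumes finite_V: "finite V" and finite_E: "finite E" and k_pos: "k > 0"
    and edge_subset: "e \<in> E \<Longrightarrow> \<phi> e \<subseteq> V" and card_edge: "e \<in> E \<Longrightarrow> card (\<phi> e) = k"
begin

lemma finite_edge: "e \<in> E \<Longrightarrow> finite (\<phi> e)"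
  using edge_subset finite_V by (rule finite_subset)

definition subnormal :: "real \<Rightarrow> ('a \<Rightarrow> 'e \<Rightarrow> real) \<Rightarrow> bool" where
  "subnormal t B \<longleftrightarrow> (\<forall>e\<in>E. (\<forall>v\<in>\<phi> e. B v e > 0) \<and> 1 \<le> t * (\<Prod>v\<in>\<phi> e. B v e)) \<and>
     (\<forall>v\<in>V. (\<Sum>e | e \<in> E \<and> v \<in> \<phi> e. B v e) \<le> 1)"

text \<open>The labels at the root \<open>u\<close> are left out: they are determined by requiring the product of the
  labels of an edge to be \<open>1 / t\<close>.\<close>

definition rooted_subnormal :: "real \<Rightarrow> 'a \<Rightarrow> ('a \<Rightarrow> 'e \<Rightarrow> real) \<Rightarrow> bool" where
  "rooted_subnormal t u \<beta> \<longleftrightarrow>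
     (\<forall>e\<in>E. (\<forall>v\<in>\<phi> e - {u}. \<beta> v e > 0) \<and> (u \<notin> \<phi> e \<longrightarrow> 1 \<le> t * (\<Prod>v\<in>\<phi> e. \<beta> v e))) \<and>
     (\<forall>v\<in>V - {u}. (\<Sum>e | e \<in> E \<and> v \<in> \<phi> e. \<beta> v e) \<le> 1) \<and>
     (\<Sum>e | e \<in> E \<and> u \<in> \<phi> e. 1 / (\<Prod>v\<in>\<phi> e - {u}. \<beta> v e)) < t"

lemma rooted_subnormal_obtains_subnormal:
  assumes t: "t > 0" and rooted: "rooted_subnormal t u \<beta>"
  obtains B where "subnormal t B" "(\<Sum>e | e \<in> E \<and> u \<in> \<phi> e. B u e) < 1"
proof -
  define B where "B v e = (if v = u then 1 / (t * (\<Prod>v\<in>\<phi> e - {u}. \<beta> v e)) else \<beta> v e)" for v e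
  have \<beta>_pos: "(\<Prod>v\<in>\<phi> e - {u}. \<beta> v e) > 0" if "e \<in> E" for e
    using rooted that unfolding rooted_subnormal_def by (intro prod_pos) blast
  have B_pos: "B v e > 0" if "e \<in> E" "v \<in> \<phi> e" for e v
    using \<beta>_pos[OF that(1)] t rooted that by (auto simp: B_def rooted_subnormal_def)
  have prod_B: "1 \<le> t * (\<Prod>v\<in>\<phi> e. B v e)" if e: "e \<in> E" for e
  proof (cases "u \<in> \<phi> e")
    case True
    then have "(\<Prod>v\<in>\<phi> e. B v e) = B u e * (\<Prod>v\<in>\<phi> e - {u}. B v e)"
      by (rule prod.remove[OF finite_edge[OF e]])
    also have "(\<Prod>v\<in>\<phi> e - {u}. B v e) = (\<Prod>v\<in>\<phi> e - {u}. \<beta> v e)"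
      by (intro prod.cong) (auto simp: B_def)
    finally show ?thesis
      using \<beta>_pos[OF e] t by (simp add: B_def)
  next
    case False
    then have "(\<Prod>v\<in>\<phi> e. B v e) = (\<Prod>v\<in>\<phi> e. \<beta> v e)"
      by (intro prod.cong) (auto simp: B_def)
    then show ?thesis
      using rooted e False by (simp add: rooted_subnormal_def)
  qed
  have "(\<Sum>e | e \<in> E \<and> u \<in> \<phi> e. B u e)
      = (\<Sum>e | e \<in> E \<and> u \<in> \<phi> e. 1 / (\<Prod>v\<in>\<phi> e - {u}. \<beta> v e)) / t"
    unfolding sum_divide_distrib by (intro sum.cong) (auto simp: B_def)
  also have "\<dots> < 1"
    using rooted t by (simp add: rooted_subnormal_def)
  finally have sum_root: "(\<Sum>e | e \<in> E \<and> u \<in> \<phi> e. B u e) < 1" .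
  have "(\<Sum>e | e \<in> E \<and> v \<in> \<phi> e. B v e) \<le> 1" if "v \<in> V" for v
    using that sum_root rooted by (cases "v = u") (simp_all add: B_def rooted_subnormal_def)
  then have "subnormal t B"
    using B_pos prod_B by (simp add: subnormal_def)
  then show ?thesis
    using sum_root by (rule that)
qed

lemma subnormal_sum_prod_less:
  fixes y :: "'a \<Rightarrow> real"
  assumes t: "t > 0" and B: "subnormal t B"
    and y: "\<And>v. v \<in> V \<Longrightarrow> y v \<ge> 0"
    and u: "u \<in> V" "y u > 0" "(\<Sum>e | e \<in> E \<and> u \<in> \<phi> e. B u e) < 1"
  shows "real k * (\<Sum>e\<in>E. prod y (\<phi> e)) < root k t * (\<Sum>v\<in>V. y v ^ k)"
proof -
  define load where "load v = (\<Sum>e | e \<in> E \<and> v \<in> \<phi> e. B v e)" for v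
  have root_pos: "root k t > 0"
    using t k_pos by simp
  have "real k * (\<Sum>e\<in>E. prod y (\<phi> e)) \<le> root k t * (\<Sum>e\<in>E. \<Sum>v\<in>\<phi> e. B v e * y v ^ k)"
    unfolding sum_distrib_left[of _ _ E]
  proof (rule sum_mono)
    fix e assume e: "e \<in> E"
    show "real k * prod y (\<phi> e) \<le> root k t * (\<Sum>v\<in>\<phi> e. B v e * y v ^ k)"
      using card_edge[OF e] edge_subset[OF e] k_pos y t B e
      by (intro weighted_arith_geom_mean) (auto simp: subnormal_def)
  qed
  also have "(\<Sum>e\<in>E. \<Sum>v\<in>\<phi> e. B v e * y v ^ k) = (\<Sum>e\<in>E. \<Sum>v | v \<in> V \<and> v \<in> \<phi> e. B v e * y v ^ k)"
    using edge_subset by (intro sum.cong) auto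
  also have "\<dots> = (\<Sum>v\<in>V. \<Sum>e | e \<in> E \<and> v \<in> \<phi> e. B v e * y v ^ k)"
    by (rule sum.swap_restrict[OF finite_E finite_V])
  also have "\<dots> = (\<Sum>v\<in>V. load v * y v ^ k)"
    by (simp add: load_def sum_distrib_right)
  also have "\<dots> < (\<Sum>v\<in>V. 1 * y v ^ k)"
  proof (rule sum_strict_mono_ex1[OF finite_V])
    show "\<forall>v\<in>V. load v * y v ^ k \<le> 1 * y v ^ k"
      using B y unfolding subnormal_def load_def by (intro ballI mult_right_mono) auto
    show "\<exists>v\<in>V. load v * y v ^ k < 1 * y v ^ k"
      using u by (intro bexI[of _ u] mult_strict_right_mono) (auto simp: load_def)
  qed
  finally show ?thesis
    using root_pos by simp
qed

end

text \<open>Each edge \<open>e\<close> may be replaced by a set \<open>\<phi> e\<close> over which the product of the entries of \<open>y\<close> is no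
  smaller. This allows edges to be moved towards the largest entry, even onto each other.\<close>

definition subnormal_after_move :: "nat \<Rightarrow> 'a hgraph \<Rightarrow> real \<Rightarrow> ('a \<Rightarrow> real) \<Rightarrow> 'a \<Rightarrow> bool" where
  "subnormal_after_move k H t y u \<longleftrightarrow> (\<exists>\<phi> \<beta>. edge_family k (verts H) (set_mset (edges H)) \<phi> \<and>
     (\<forall>e\<in>set_mset (edges H). prod y e \<le> prod y (\<phi> e)) \<and>
     edge_family.rooted_subnormal (verts H) (set_mset (edges H)) \<phi> t u \<beta>)"

lemma eigenvalue_moduli:
  assumes H: "multi_kgraph k H" "k > 0" and ev: "hgraph_eigenvalue k H \<mu>"
  obtains y :: "'a \<Rightarrow> real" where "\<And>v. y v \<ge> 0" "\<exists>v\<in>verts H. y v > 0"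
    "cmod \<mu> * (\<Sum>v\<in>verts H. y v ^ k)
      \<le> real k * (\<Sum>e\<in>set_mset (edges H). real (count (edges H) e) * prod y e)"
proof -
  obtain x where nonzero: "\<exists>v\<in>verts H. x v \<noteq> 0"
    and eigen: "\<And>v. v \<in> verts H \<Longrightarrow> link_sum H x v = \<mu> * x v ^ (k - 1)"
    using ev hgraph_eigenvalue_iff[OF H(1)] by auto
  define y where "y v = cmod (x v)" for v
  have "cmod \<mu> * (\<Sum>v\<in>verts H. y v ^ k) = (\<Sum>v\<in>verts H. y v * cmod (link_sum H x v))"
    unfolding sum_distrib_left using H(2)
    by (intro sum.cong refl, cases k) (simp_all add: eigen norm_mult norm_power y_def)
  also have "\<dots> \<le> (\<Sum>v\<in>verts H. y v * link_sum H y v)"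
    unfolding y_def by (intro sum_mono mult_left_mono norm_link_sum_le) auto
  also have "\<dots> = real k * (\<Sum>e\<in>set_mset (edges H). real (count (edges H) e) * prod y e)"
    by (simp add: mult_link_sum[OF H(1)] sum_star_sum[OF H(1)])
  finally show ?thesis
    using nonzero by (intro that[of y]) (auto simp: y_def)
qed

lemma rho_less_root:
  assumes H: "kgraph k H" and k: "k \<ge> 3" and t: "t > 0"
    and move: "\<And>y u. (\<And>v. y v \<ge> 0) \<Longrightarrow> u \<in> verts H \<Longrightarrow> (\<And>v. v \<in> verts H \<Longrightarrow> y v \<le> y u) \<Longrightarrow>
      subnormal_after_move k H t y u"
  shows "rho k H < root k t"
proof -
  have simple: "count (edges H) e = 1" if "e \<in># edges H" for e
    using H that by (auto simp: kgraph_def le_antisym Suc_le_eq)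
  have multi: "multi_kgraph k H"
    using H by (simp add: kgraph_def)
  note multiD = multi_kgraphD[OF multi]
  obtain \<mu> where \<mu>: "hgraph_eigenvalue k H \<mu>" "rho k H = cmod \<mu>"
    using rho_attained[OF multi k] by blast
  obtain y where y: "\<And>v. y v \<ge> 0" "\<exists>v\<in>verts H. y v > 0"
    and rho_le: "cmod \<mu> * (\<Sum>v\<in>verts H. y v ^ k)
      \<le> real k * (\<Sum>e\<in>set_mset (edges H). real (count (edges H) e) * prod y e)"
    using k by (elim eigenvalue_moduli[OF multi _ \<mu>(1), rotated]) simp
  obtain u where u: "u \<in> verts H" "\<And>v. v \<in> verts H \<Longrightarrow> y v \<le> y u"
    using finite_nonempty_obtains_maximizer[OF multiD(1,2), of y] by blast
  have yu: "y u > 0"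
    using u y(2) by fastforce
  obtain \<phi> \<beta> where fam: "edge_family k (verts H) (set_mset (edges H)) \<phi>"
    and le: "\<And>e. e \<in># edges H \<Longrightarrow> prod y e \<le> prod y (\<phi> e)"
    and \<beta>: "edge_family.rooted_subnormal (verts H) (set_mset (edges H)) \<phi> t u \<beta>"
    using move[of y u, OF y(1) u] unfolding subnormal_after_move_def by blast
  interpret edge_family k "verts H" "set_mset (edges H)" \<phi>
    by (rule fam)
  obtain B where B: "subnormal t B" "(\<Sum>e | e \<in># edges H \<and> u \<in> \<phi> e. B u e) < 1"
    using rooted_subnormal_obtains_subnormal[OF t \<beta>] by blast
  note rho_le
  also have "real k * (\<Sum>e\<in>set_mset (edges H). real (count (edges H) e) * prod y e)
      \<le> real k * (\<Sum>e\<in>set_mset (edges H). prod y (\<phi> e))"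
    using le simple by (intro mult_left_mono sum_mono) auto
  also have "\<dots> < root k t * (\<Sum>v\<in>verts H. y v ^ k)"
    using y(1) by (intro subnormal_sum_prod_less[where B = B and u = u] t B u(1) yu)
  finally have "cmod \<mu> * (\<Sum>v\<in>verts H. y v ^ k) < root k t * (\<Sum>v\<in>verts H. y v ^ k)" .
  moreover have "(\<Sum>v\<in>verts H. y v ^ k) \<ge> 0"
    using y(1) by (simp add: sum_nonneg)
  ultimately show ?thesis
    using \<mu>(2) by (simp add: mult_less_cancel_right)
qed

section \<open>Hypergraphs with a core\<close>

definition vertex_degree :: "'a set multiset \<Rightarrow> 'a \<Rightarrow> nat" where
  "vertex_degree M v = size {#e \<in># M. v \<in> e#}"

lemma vertex_degree_empty [simp]: "vertex_degree {#} v = 0"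
  by (simp add: vertex_degree_def)

lemma vertex_degree_add_mset [simp]:
  "vertex_degree (add_mset e M) v = (if v \<in> e then 1 else 0) + vertex_degree M v"
  by (simp add: vertex_degree_def)

lemma vertex_degree_eq_0_iff: "vertex_degree M v = 0 \<longleftrightarrow> v \<notin> \<Union>(set_mset M)"
  by (auto simp: vertex_degree_def filter_mset_eq_mempty_iff)

lemma vertex_degree_add_mset_le_1_iff:
  "(\<forall>v. v \<notin> C \<longrightarrow> vertex_degree (add_mset e M) v \<le> 1)
    \<longleftrightarrow> (\<forall>v. v \<notin> C \<longrightarrow> vertex_degree M v \<le> 1) \<and> e \<inter> \<Union>(set_mset M) \<subseteq> C"
proof -
  have "vertex_degree (add_mset e M) v \<le> 1 \<longleftrightarrow> vertex_degree M v \<le> 1 \<and> (v \<in> e \<longrightarrow> v \<notin> \<Union>(set_mset M))" for v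
    unfolding vertex_degree_eq_0_iff[symmetric] by auto
  then show ?thesis
    by (simp only:) blast
qed

lemma bij_betw_extend_equicard:
  assumes f: "bij_betw f X X'" and img: "f ` (e \<inter> X) = e' \<inter> X'"
    and fin: "finite e" "finite e'" and card: "card e = card e'"
  obtains f' where "bij_betw f' (X \<union> e) (X' \<union> e')" "\<And>x. x \<in> X \<Longrightarrow> f' x = f x" "f' ` e = e'"
proof -
  have "card (e' \<inter> X') = card (e \<inter> X)"
    unfolding img[symmetric] using f by (intro card_image) (auto simp: bij_betw_def intro: inj_on_subset)
  then have "card (e - X) = card (e' - X')"
    using fin card by (simp add: card_Diff_subset_Int)
  then obtain h where h: "bij_betw h (e - X) (e' - X')"
    using fin by (meson bij_betw_iff_card finite_Diff)
  define f' where "f' x = (if x \<in> X then f x else h x)" for x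
  have old: "bij_betw f' X X'"
    using f by (subst bij_betw_cong[of _ f' f]) (auto simp: f'_def)
  have new: "bij_betw f' (e - X) (e' - X')"
    using h by (subst bij_betw_cong[of _ f' h]) (auto simp: f'_def)
  have "bij_betw f' (X \<union> e) (X' \<union> e')"
    using bij_betw_combine[OF old new] by (simp add: Un_Diff_cancel Diff_disjoint)
  moreover have "f' ` e = e'"
  proof -
    have "f' ` e = f' ` (e \<inter> X) \<union> f' ` (e - X)"
      by blast
    also have "f' ` (e \<inter> X) = e' \<inter> X'"
      unfolding img[symmetric] by (intro image_cong) (auto simp: f'_def)
    also have "f' ` (e - X) = e' - X'"
      using new by (rule bij_betw_imp_surj_on)
    finally show ?thesis by blast
  qed
  ultimately show ?thesis
    by (intro that[of f']) (auto simp: f'_def)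
qed

lemma bij_betw_extend_core:
  assumes g: "bij_betw g C C'"
    and traces: "{#g ` (e \<inter> C). e \<in># M#} = {#e \<inter> C'. e \<in># M'#}"
    and "\<And>e. e \<in># M \<Longrightarrow> finite e \<and> card e = k" "\<And>e. e \<in># M' \<Longrightarrow> finite e \<and> card e = k"
    and "\<forall>v. v \<notin> C \<longrightarrow> vertex_degree M v \<le> 1" "\<forall>v. v \<notin> C' \<longrightarrow> vertex_degree M' v \<le> 1"
  shows "\<exists>f. bij_betw f (C \<union> \<Union>(set_mset M)) (C' \<union> \<Union>(set_mset M')) \<and> (\<forall>v\<in>C. f v = g v) \<and>
    {#f ` e. e \<in># M#} = M'"
  using assms(2-)
proof (induction M arbitrary: M')
  case empty
  then have "M' = {#}" by (metis image_mset_is_empty_iff)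
  with g show ?case by auto
next
  case (add e M)
  from add.prems(1) have "{#e \<inter> C'. e \<in># M'#} = add_mset (g ` (e \<inter> C)) {#g ` (e \<inter> C). e \<in># M#}"
    by simp
  then obtain e' N where M': "M' = add_mset e' N" and e': "e' \<inter> C' = g ` (e \<inter> C)"
    and N: "{#e \<inter> C'. e \<in># N#} = {#g ` (e \<inter> C). e \<in># M#}"
    using msed_map_invR[of "\<lambda>e. e \<inter> C'" M'] by blast
  define X where "X = C \<union> \<Union>(set_mset M)"
  define X' where "X' = C' \<union> \<Union>(set_mset N)"
  have deg: "\<forall>v. v \<notin> C \<longrightarrow> vertex_degree M v \<le> 1" "e \<inter> \<Union>(set_mset M) \<subseteq> C"
    using add.prems(4) unfolding vertex_degree_add_mset_le_1_iff by auto
  have deg': "\<forall>v. v \<notin> C' \<longrightarrow> vertex_degree N v \<le> 1" "e' \<inter> \<Union>(set_mset N) \<subseteq> C'"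
    using add.prems(5) unfolding M' vertex_degree_add_mset_le_1_iff by auto
  obtain f where f: "bij_betw f X X'" "\<And>v. v \<in> C \<Longrightarrow> f v = g v" "{#f ` e. e \<in># M#} = N"
    using add.IH[OF N[symmetric] _ _ deg(1) deg'(1)] add.prems(2,3) by (auto simp: X_def X'_def M')
  have fin: "finite e" "finite e'" "card e = card e'"
    using add.prems(2)[of e] add.prems(3)[of e'] by (auto simp: M')
  have "f ` (e \<inter> X) = g ` (e \<inter> C)"
    using deg(2) f(2) by (intro image_cong) (auto simp: X_def)
  also have "\<dots> = e' \<inter> X'"
    unfolding e'[symmetric] using deg'(2) by (auto simp: X'_def)
  finally obtain f' where f': "bij_betw f' (X \<union> e) (X' \<union> e')" "\<And>v. v \<in> X \<Longrightarrow> f' v = f v" "f' ` e = e'"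
    by (rule bij_betw_extend_equicard[OF f(1) _ fin]) blast
  have "{#f' ` d. d \<in># M#} = N"
    unfolding f(3)[symmetric] using f'(2) by (intro image_mset_cong image_cong) (auto simp: X_def)
  moreover have "X \<union> e = C \<union> \<Union>(set_mset (add_mset e M))" "X' \<union> e' = C' \<union> \<Union>(set_mset M')"
    by (auto simp: X_def X'_def M')
  moreover have "\<forall>v\<in>C. f' v = g v"
    using f(2) f'(2) by (simp add: X_def)
  ultimately show ?case
    using f'(1,3) by (auto simp: M')
qed

definition cored_kgraph :: "nat \<Rightarrow> 'a hgraph \<Rightarrow> 'a set \<Rightarrow> 'a set multiset \<Rightarrow> bool" where
  "cored_kgraph k H C T \<longleftrightarrow> multi_kgraph k H \<and> C \<subseteq> verts H \<and>
     (\<forall>v\<in>verts H - C. vertex_degree (edges H) v = 1) \<and> {#e \<inter> C. e \<in># edges H#} = T"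

lemma cored_kgraph_verts:
  assumes "cored_kgraph k H C T"
  shows "verts H = C \<union> \<Union>(set_mset (edges H))"
proof -
  have "v \<in> \<Union>(set_mset (edges H))" if "v \<in> verts H - C" for v
    using assms that vertex_degree_eq_0_iff[of "edges H" v] by (auto simp: cored_kgraph_def)
  moreover have "C \<subseteq> verts H" "\<And>e. e \<in># edges H \<Longrightarrow> e \<subseteq> verts H"
    using assms multi_kgraphD(3)[of k H] by (auto simp: cored_kgraph_def)
  ultimately show ?thesis by blast
qed

lemma cored_kgraph_vertex_degree_le_1:
  assumes "cored_kgraph k H C T" "v \<notin> C"
  shows "vertex_degree (edges H) v \<le> 1"
proof (cases "v \<in> verts H")
  case True
  then show ?thesis using assms by (simp add: cored_kgraph_def)
next
  case False
  then have "vertex_degree (edges H) v = 0"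
    unfolding vertex_degree_eq_0_iff cored_kgraph_verts[OF assms(1)] by blast
  then show ?thesis by simp
qed

lemma cored_kgraph_iso:
  assumes H: "cored_kgraph k H C T" and G: "cored_kgraph k G C' {#g ` \<tau>. \<tau> \<in># T#}"
    and g: "bij_betw g C C'"
  shows "hgraph_iso H G"
proof -
  have multi: "multi_kgraph k H" "multi_kgraph k G"
    using H G by (auto simp: cored_kgraph_def)
  have "{#g ` (e \<inter> C). e \<in># edges H#} = {#e \<inter> C'. e \<in># edges G#}"
    using H G by (auto simp: cored_kgraph_def multiset.map_comp comp_def)
  then have "\<exists>f. bij_betw f (C \<union> \<Union>(set_mset (edges H))) (C' \<union> \<Union>(set_mset (edges G))) \<and>
      (\<forall>v\<in>C. f v = g v) \<and> {#f ` e. e \<in># edges H#} = edges G"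
    using multi_kgraphD[OF multi(1)] multi_kgraphD[OF multi(2)]
      cored_kgraph_vertex_degree_le_1[OF H] cored_kgraph_vertex_degree_le_1[OF G]
    by (intro bij_betw_extend_core[OF g]) auto
  then show ?thesis
    unfolding hgraph_iso_def cored_kgraph_verts[OF H] cored_kgraph_verts[OF G] by blast
qed

lemma cored_kgraph_edgeless: "finite C \<Longrightarrow> C \<noteq> {} \<Longrightarrow> cored_kgraph k (C, {#}) C {#}"
  by (simp add: cored_kgraph_def multi_kgraph_def)

lemma cored_kgraph_add_edge:
  assumes H: "cored_kgraph k (V, M) C T" and \<tau>: "\<tau> \<subseteq> C"
    and N: "finite N" "N \<inter> V = {}" "card \<tau> + card N = k"
  shows "cored_kgraph k (V \<union> N, add_mset (\<tau> \<union> N) M) C (add_mset \<tau> T)"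
proof -
  have multi: "multi_kgraph k (V, M)" and C: "C \<subseteq> V"
    using H by (auto simp: cored_kgraph_def)
  note multiD = multi_kgraphD[OF multi, simplified]
  have "card (\<tau> \<union> N) = k"
    using N \<tau> C multiD(1) by (subst card_Un_disjoint) (auto intro: finite_subset)
  then have "multi_kgraph k (V \<union> N, add_mset (\<tau> \<union> N) M)"
    using multi \<tau> C N(1) by (auto simp: multi_kgraph_def)
  moreover have "vertex_degree M v = 0" if "v \<in> N" for v
    using that N(2) multiD(3) unfolding vertex_degree_eq_0_iff by blast
  then have "vertex_degree (add_mset (\<tau> \<union> N) M) v = 1" if "v \<in> V \<union> N - C" for v
    using that H \<tau> N(2) C by (auto simp: cored_kgraph_def)
  moreover have "(\<tau> \<union> N) \<inter> C = \<tau>"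
    using \<tau> C N(2) by blast
  ultimately show ?thesis
    using H by (auto simp: cored_kgraph_def)
qed

lemma cored_kgraph_attach_pendent:
  assumes H: "cored_kgraph k H C T" and x: "x \<in> C" and k: "k \<ge> 1"
  shows "cored_kgraph k (attach_pendent k x H) C (add_mset {x} T)"
proof -
  define N where "N = {Max (verts H) <.. Max (verts H) + (k - 1)}"
  have "finite (verts H)"
    using H multi_kgraphD(1)[of k H] by (simp add: cored_kgraph_def)
  then have "N \<inter> verts H = {}"
    by (fastforce simp: N_def dest: Max_ge)
  then have "cored_kgraph k (verts H \<union> N, add_mset ({x} \<union> N) (edges H)) C (add_mset {x} T)"
    using H x k by (intro cored_kgraph_add_edge) (auto simp: N_def)
  then show ?thesis
    by (simp add: attach_pendent_def Let_def N_def)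
qed

lemma cored_kgraph_attach_pendents:
  assumes "cored_kgraph k H C T" "x \<in> C" "k \<ge> 1"
  shows "cored_kgraph k ((attach_pendent k x ^^ a) H) C (T + replicate_mset a {x})"
  by (induction a) (use assms in \<open>auto intro: cored_kgraph_attach_pendent\<close>)

lemma sum_mset_eq_sum_count:
  fixes f :: "'a \<Rightarrow> 'b::comm_semiring_1"
  assumes "finite A" "set_mset M \<subseteq> A"
  shows "(\<Sum>e\<in>#M. f e) = (\<Sum>e\<in>A. of_nat (count M e) * f e)"
  using assms(2)
proof (induction M)
  case (add e M)
  have "(\<Sum>a\<in>A. of_nat (count (add_mset e M) a) * f a)
      = (\<Sum>a\<in>A. of_nat (count M a) * f a + (if a = e then f a else 0))"
    by (intro sum.cong) (auto simp: algebra_simps)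
  with add assms(1) show ?case
    by (simp add: sum.distrib add.commute)
qed simp

lemma star_sum_eq_sum_mset: "star_sum H f v = (\<Sum>e\<in>#{#e \<in># edges H. v \<in> e#}. f e)"
proof -
  have "(\<Sum>e\<in>#{#e \<in># edges H. v \<in> e#}. f e)
      = (\<Sum>e\<in>edges_at H v. of_nat (count {#e \<in># edges H. v \<in> e#} e) * f e)"
    by (rule sum_mset_eq_sum_count) auto
  then show ?thesis
    by (simp add: star_sum_def)
qed

lemma star_sum_in_core:
  assumes "cored_kgraph k H C T" "v \<in> C"
  shows "star_sum H (\<lambda>e. F (e \<inter> C)) v = (\<Sum>\<tau>\<in>#{#\<tau> \<in># T. v \<in> \<tau>#}. F \<tau>)"
proof -
  have "{#\<tau> \<in># T. v \<in> \<tau>#} = {#e \<inter> C. e \<in># {#e \<in># edges H. v \<in> e#}#}"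
    using assms by (auto simp: cored_kgraph_def filter_mset_image_mset intro!: image_mset_cong_pair)
  then show ?thesis
    by (simp add: star_sum_eq_sum_mset multiset.map_comp comp_def)
qed

lemma star_sum_outside_core:
  assumes "cored_kgraph k H C T" "e \<in># edges H" "v \<in> e - C"
  shows "star_sum H f v = f e"
proof -
  have "vertex_degree (edges H) v \<le> 1"
    using cored_kgraph_vertex_degree_le_1[OF assms(1)] assms(3) by blast
  moreover have "e \<in># {#e \<in># edges H. v \<in> e#}"
    using assms by simp
  ultimately have "{#e \<in># edges H. v \<in> e#} = {#e#}"
    unfolding vertex_degree_def by (auto dest!: multi_member_split)
  then show ?thesis
    by (simp add: star_sum_eq_sum_mset)
qed

lemma rho_cored_kgraph:
  fixes F :: "'a set \<Rightarrow> real"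
  assumes H: "cored_kgraph k H C T" and k: "k \<ge> 1" and t: "t > 0"
    and F_pos: "\<And>\<tau>. \<tau> \<in># T \<Longrightarrow> F \<tau> > 0" and cover: "C \<subseteq> \<Union>(set_mset T)"
    and S: "\<And>v. v \<in> C \<Longrightarrow> S v = (\<Sum>\<tau>\<in>#{#\<tau> \<in># T. v \<in> \<tau>#}. F \<tau>)"
    and prod_eq: "\<And>\<tau>. \<tau> \<in># T \<Longrightarrow> prod S \<tau> = t * F \<tau> ^ card \<tau>"
  shows "rho k H = root k t"
proof (rule rho_eq_root[OF _ k t])
  show multi: "multi_kgraph k H"
    using H by (simp add: cored_kgraph_def)
  note multiD = multi_kgraphD[OF multi]
  have T: "T = {#e \<inter> C. e \<in># edges H#}"
    using H by (simp add: cored_kgraph_def)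
  have "C \<subseteq> \<Union>(set_mset (edges H))"
    using cover unfolding T by auto
  then show "verts H \<subseteq> \<Union>(set_mset (edges H))"
    using cored_kgraph_verts[OF H] by blast
  show "F (e \<inter> C) > 0" if "e \<in># edges H" for e
    using F_pos that unfolding T by auto
  show "prod (star_sum H (\<lambda>e. F (e \<inter> C))) e = t * F (e \<inter> C) ^ k" if e: "e \<in># edges H" for e
  proof -
    let ?S = "star_sum H (\<lambda>e. F (e \<inter> C))"
    have "prod ?S e = prod ?S (e \<inter> C) * prod ?S (e - C)"
      by (rule prod.Int_Diff[OF multiD(5)[OF e]])
    also have "prod ?S (e \<inter> C) = prod S (e \<inter> C)"
      by (intro prod.cong) (auto simp: S star_sum_in_core[OF H])
    also have "\<dots> = t * F (e \<inter> C) ^ card (e \<inter> C)"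
      using e T by (intro prod_eq) auto
    also have "prod ?S (e - C) = F (e \<inter> C) ^ card (e - C)"
      by (simp add: star_sum_outside_core[OF H e])
    finally show ?thesis
      using card_Int_Diff[OF multiD(5)[OF e], of C] multiD(4)[OF e] by (simp add: power_add)
  qed
qed

section \<open>The extremal hypergraphs\<close>

lemma cored_kgraph_B2:
  assumes k: "k \<ge> 3"
  shows "cored_kgraph k (B2 k a b) {0, 1}
    (replicate_mset 3 {0, 1} + replicate_mset a {0} + replicate_mset b {1})"
proof -
  let ?N\<^sub>1 = "{2..<k}" and ?N\<^sub>2 = "{k..<2 * k - 2}" and ?N\<^sub>3 = "{2 * k - 2..<3 * k - 4}"
  have "cored_kgraph k ({0, 1} \<union> ?N\<^sub>3 \<union> ?N\<^sub>2 \<union> ?N\<^sub>1, {#{0, 1} \<union> ?N\<^sub>1, {0, 1} \<union> ?N\<^sub>2, {0, 1} \<union> ?N\<^sub>3#})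
      {0, 1} {#{0, 1}, {0, 1}, {0, 1}#}"
    using k by (intro cored_kgraph_add_edge cored_kgraph_edgeless) auto
  moreover have "{0, 1} \<union> ?N\<^sub>3 \<union> ?N\<^sub>2 \<union> ?N\<^sub>1 = {0..<3 * k - 4}"
    using k by auto
  ultimately have "cored_kgraph k ({0..<3 * k - 4}, {#{0, 1} \<union> ?N\<^sub>1, {0, 1} \<union> ?N\<^sub>2, {0, 1} \<union> ?N\<^sub>3#})
      {0, 1} (replicate_mset 3 {0, 1})"
    by (simp add: numeral_3_eq_3)
  then show ?thesis
    unfolding B2_def using k by (intro cored_kgraph_attach_pendents) auto
qed

lemma cored_kgraph_B31:
  assumes k: "k \<ge> 3"
  shows "cored_kgraph k (B31 k a b c) {0, 1, 2}
    (replicate_mset 2 {0, 1, 2} + replicate_mset a {0} + replicate_mset b {1} + replicate_mset c {2})"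
proof -
  let ?N\<^sub>1 = "{3..<k}" and ?N\<^sub>2 = "{k..<2 * k - 3}"
  have "cored_kgraph k ({0, 1, 2} \<union> ?N\<^sub>2 \<union> ?N\<^sub>1, {#{0, 1, 2} \<union> ?N\<^sub>1, {0, 1, 2} \<union> ?N\<^sub>2#})
      {0, 1, 2} {#{0, 1, 2}, {0, 1, 2}#}"
    using k by (intro cored_kgraph_add_edge cored_kgraph_edgeless) auto
  moreover have "{0, 1, 2} \<union> ?N\<^sub>2 \<union> ?N\<^sub>1 = {0..<2 * k - 3}"
    using k by auto
  ultimately have "cored_kgraph k ({0..<2 * k - 3}, {#{0, 1, 2} \<union> ?N\<^sub>1, {0, 1, 2} \<union> ?N\<^sub>2#})
      {0, 1, 2} (replicate_mset 2 {0, 1, 2})"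
    by (simp add: numeral_2_eq_2)
  then show ?thesis
    unfolding B31_def using k by (intro cored_kgraph_attach_pendents) auto
qed

lemma filter_replicate_mset [simp]:
  "filter_mset P (replicate_mset n x) = (if P x then replicate_mset n x else {#})"
  by (induction n) auto

lemma rho_B2:
  assumes k: "k \<ge> 3" and t: "t > real b" "(t - real a) * (t - real b) = 9 * t"
  shows "rho k (B2 k a b) = root k t"
proof -
  have "t > 0" "k \<ge> 1"
    using t(1) k by linarith+
  define c where "c = 3 * t / (t - real b)"
  have c_pos: "c > 0"
    using t(1) by (simp add: c_def)
  have sum_0: "3 * c + real a = t"
    using t by (simp add: c_def field_simps)
  have "3 * t + real b * c = c * t"
    using t by (simp add: c_def field_simps)
  then have "c * (3 * t + real b * c) = c * (c * t)"
    by simp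
  then have sum_1: "3 * c + real b * (c\<^sup>2 / t) = c\<^sup>2"
    using \<open>t > 0\<close> by (simp add: field_simps power2_eq_square)
  define F :: "nat set \<Rightarrow> real" where
    "F \<tau> = (if \<tau> = {0, 1} then c else if \<tau> = {0} then 1 else c\<^sup>2 / t)" for \<tau>
  define S :: "nat \<Rightarrow> real" where "S v = (if v = 0 then t else c\<^sup>2)" for v
  have F_simps: "F {0, 1} = c" "F {0} = 1" "F {1} = c\<^sup>2 / t"
    by (auto simp: F_def doubleton_eq_iff)
  show ?thesis
  proof (rule rho_cored_kgraph[OF cored_kgraph_B2[OF k] \<open>k \<ge> 1\<close> \<open>t > 0\<close>, where F = F and S = S])
    let ?T = "replicate_mset 3 {0, 1} + replicate_mset a {0} + replicate_mset b {1 :: nat}"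
    show "F \<tau> > 0" for \<tau>
      using c_pos \<open>t > 0\<close> by (simp add: F_def)
    show "S v = (\<Sum>\<tau>\<in>#{#\<tau> \<in># ?T. v \<in> \<tau>#}. F \<tau>)" if "v \<in> {0, 1}" for v
      using that sum_0 sum_1 F_simps by (auto simp: S_def)
    show "prod S \<tau> = t * F \<tau> ^ card \<tau>" if \<tau>: "\<tau> \<in># ?T" for \<tau>
    proof -
      consider "\<tau> = {0, 1}" | "\<tau> = {0}" | "\<tau> = {1}"
        using \<tau> by (auto split: if_splits)
      then show ?thesis
        using \<open>t > 0\<close> F_simps by cases (simp_all add: S_def power2_eq_square)
    qed
  qed auto
qed

lemma rho_B31:
  assumes k: "k \<ge> 3"
  shows "rho k (B31 k a 0 0) = root k (real a + 8)"
proof -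
  define F :: "nat set \<Rightarrow> real" where "F \<tau> = (if \<tau> = {0} then 1 else 4)" for \<tau>
  define S :: "nat \<Rightarrow> real" where "S v = (if v = 0 then real a + 8 else 8)" for v
  have F_simps: "F {0, 1, 2} = 4" "F {0} = 1"
    by (auto simp: F_def)
  show ?thesis
  proof (rule rho_cored_kgraph[OF cored_kgraph_B31[OF k], where F = F and S = S])
    let ?T = "replicate_mset 2 {0, 1, 2} + replicate_mset a {0}
      + replicate_mset 0 {1} + replicate_mset 0 {2 :: nat}"
    show "F \<tau> > 0" for \<tau>
      by (simp add: F_def)
    show "S v = (\<Sum>\<tau>\<in>#{#\<tau> \<in># ?T. v \<in> \<tau>#}. F \<tau>)" if "v \<in> {0, 1, 2}" for v
      using that F_simps by (auto simp: S_def)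
    show "prod S \<tau> = (real a + 8) * F \<tau> ^ card \<tau>" if \<tau>: "\<tau> \<in># ?T" for \<tau>
    proof -
      consider "\<tau> = {0, 1, 2}" | "\<tau> = {0}"
        using \<tau> by (auto split: if_splits)
      then show ?thesis
        using F_simps by cases (simp_all add: S_def)
    qed
  qed (use k in auto)
qed

lemma kgraph_edges_eq_mset_set:
  assumes "kgraph k H"
  shows "edges H = mset_set (set_mset (edges H))"
proof (rule multiset_eqI)
  fix e
  have "count (edges H) e \<le> 1"
    using assms by (simp add: kgraph_def)
  then show "count (edges H) e = count (mset_set (set_mset (edges H))) e"
    by (cases "e \<in># edges H") (auto simp: not_in_iff Suc_le_eq le_antisym)
qed

lemma kgraph_vertex_degree:
  assumes "kgraph k H"
  shows "vertex_degree (edges H) v = card (edges_at H v)"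
  by (subst kgraph_edges_eq_mset_set[OF assms]) (simp add: vertex_degree_def)

lemma image_mset_mset_set_eq_sum:
  assumes "finite A" "finite B" "f ` A \<subseteq> B"
  shows "image_mset f (mset_set A) = (\<Sum>b\<in>B. replicate_mset (card {a \<in> A. f a = b}) b)"
proof (rule multiset_eqI)
  fix b
  have "{a \<in> A. f a = b} = {}" if "b \<notin> B"
    using that assms(3) by auto
  then show "count (image_mset f (mset_set A)) b
      = count (\<Sum>b\<in>B. replicate_mset (card {a \<in> A. f a = b}) b) b"
    using assms by (simp add: count_image_mset_eq_card_vimage count_sum sum.delta)
qed

lemma kgraph_cored_kgraph:
  assumes H: "kgraph k H" and C: "C \<subseteq> verts H"
    and deg: "\<And>x. x \<in> verts H - C \<Longrightarrow> card (edges_at H x) = 1"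
    and traces: "finite \<T>" "\<And>e. e \<in># edges H \<Longrightarrow> e \<inter> C \<in> \<T>"
  shows "cored_kgraph k H C
    (\<Sum>\<tau>\<in>\<T>. replicate_mset (card {e. e \<in># edges H \<and> e \<inter> C = \<tau>}) \<tau>)"
proof -
  have "{#e \<inter> C. e \<in># mset_set (set_mset (edges H))#}
      = (\<Sum>\<tau>\<in>\<T>. replicate_mset (card {e \<in> set_mset (edges H). e \<inter> C = \<tau>}) \<tau>)"
    using traces by (intro image_mset_mset_set_eq_sum) auto
  then show ?thesis
    using C deg H by (simp add: cored_kgraph_def kgraph_vertex_degree[OF H] kgraph_def
        flip: kgraph_edges_eq_mset_set[OF H])
qed

lemma iso_B2:
  assumes H: "kgraph k H" and k: "k \<ge> 3"
    and uv: "u \<in> verts H" "v \<in> verts H" "u \<noteq> v"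
    and deg: "\<And>x. x \<in> verts H - {u, v} \<Longrightarrow> card (edges_at H x) = 1"
    and meets: "\<And>e. e \<in># edges H \<Longrightarrow> u \<in> e \<or> v \<in> e"
    and both: "card {e. e \<in># edges H \<and> u \<in> e \<and> v \<in> e} = 3"
  shows "hgraph_iso H (B2 k (card (edges_avoiding H v)) (card (edges_avoiding H u)))"
proof -
  let ?\<T> = "{{u, v}, {u}, {v}}"
  have "{e. e \<in># edges H \<and> e \<inter> {u, v} = {u, v}} = {e. e \<in># edges H \<and> u \<in> e \<and> v \<in> e}"
    "{e. e \<in># edges H \<and> e \<inter> {u, v} = {u}} = edges_avoiding H v"
    "{e. e \<in># edges H \<and> e \<inter> {u, v} = {v}} = edges_avoiding H u"
    using meets uv(3) by (auto simp: Int_insert_right doubleton_eq_iff split: if_splits)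
  moreover have "cored_kgraph k H {u, v}
      (\<Sum>\<tau>\<in>?\<T>. replicate_mset (card {e. e \<in># edges H \<and> e \<inter> {u, v} = \<tau>}) \<tau>)"
    using uv meets by (intro kgraph_cored_kgraph[OF H _ deg]) auto
  ultimately have core: "cored_kgraph k H {u, v} (replicate_mset 3 {u, v}
      + replicate_mset (card (edges_avoiding H v)) {u}
      + replicate_mset (card (edges_avoiding H u)) {v})"
    using uv(3) both by (simp add: doubleton_eq_iff add.assoc)
  show ?thesis
    by (rule cored_kgraph_iso[OF core, where g = "\<lambda>x. if x = u then 0 else 1"])
      (use cored_kgraph_B2[OF k] uv(3) in \<open>auto simp: insert_commute bij_betw_def inj_on_def\<close>)
qed

lemma iso_B31:
  assumes H: "kgraph k H" and k: "k \<ge> 3"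
    and uvw: "u \<in> verts H" "v \<in> verts H" "w \<in> verts H" "u \<noteq> v" "u \<noteq> w" "v \<noteq> w"
    and deg: "\<And>x. x \<in> verts H - {u, v, w} \<Longrightarrow> card (edges_at H x) = 1"
    and root: "\<And>e. e \<in># edges H \<Longrightarrow> u \<in> e"
    and twins: "\<And>e. e \<in># edges H \<Longrightarrow> v \<in> e \<longleftrightarrow> w \<in> e"
    and both: "card (edges_at H v) = 2"
  shows "hgraph_iso H (B31 k (card (edges_avoiding H v)) 0 0)"
proof -
  let ?\<T> = "{{u, v, w}, {u}}"
  have "{e. e \<in># edges H \<and> e \<inter> {u, v, w} = {u, v, w}} = edges_at H v"
    "{e. e \<in># edges H \<and> e \<inter> {u, v, w} = {u}} = edges_avoiding H v"
    using root twins uvw by (auto simp: Int_insert_right split: if_splits)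
  moreover have "cored_kgraph k H {u, v, w}
      (\<Sum>\<tau>\<in>?\<T>. replicate_mset (card {e. e \<in># edges H \<and> e \<inter> {u, v, w} = \<tau>}) \<tau>)"
    using uvw root twins by (intro kgraph_cored_kgraph[OF H _ deg]) auto
  moreover have "{u, v, w} \<noteq> {u}"
    using uvw by auto
  ultimately have core: "cored_kgraph k H {u, v, w} (replicate_mset 2 {u, v, w}
      + replicate_mset (card (edges_avoiding H v)) {u})"
    using both by simp
  show ?thesis
    by (rule cored_kgraph_iso[OF core, where g = "\<lambda>x. if x = u then 0 else if x = v then 1 else 2"])
      (use cored_kgraph_B31[OF k, of _ 0 0] uvw in \<open>auto simp: insert_commute bij_betw_def inj_on_def\<close>)
qed

section \<open>Moving edges to a root\<close>

definition adjacency :: "'a hgraph \<Rightarrow> ('a \<times> 'a) set" where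
  "adjacency H = {(v, w). \<exists>e. e \<in># edges H \<and> v \<in> e \<and> w \<in> e}"

definition hdist :: "'a hgraph \<Rightarrow> 'a \<Rightarrow> 'a \<Rightarrow> nat" where
  "hdist H u v = (LEAST n. (u, v) \<in> adjacency H ^^ n)"

lemma hpath_imp_rtrancl_adjacency:
  assumes path: "hpath H vs es" and "u \<in> set vs" "v \<in> set vs"
  shows "(u, v) \<in> (adjacency H)\<^sup>*"
proof -
  have from_start: "(vs ! 0, vs ! n) \<in> (adjacency H)\<^sup>*" if "n < length vs" for n
    using that
  proof (induction n)
    case (Suc n)
    then have n: "n < length es" using path by (simp add: hpath_def)
    then have "es ! n \<in># edges H"
      using path unfolding hpath_def by (meson mset_subset_eqD nth_mem_mset)
    then have "(vs ! n, vs ! Suc n) \<in> adjacency H"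
      using path n unfolding hpath_def adjacency_def by blast
    then show ?case
      using Suc by (meson Suc_lessD rtrancl.rtrancl_into_rtrancl)
  qed simp
  have "sym ((adjacency H)\<^sup>*)"
    by (rule sym_rtrancl) (auto simp: adjacency_def sym_def)
  moreover have "(vs ! 0, u) \<in> (adjacency H)\<^sup>*" "(vs ! 0, v) \<in> (adjacency H)\<^sup>*"
    using assms(2,3) from_start by (auto simp: in_set_conv_nth)
  ultimately show ?thesis
    by (meson rtrancl_trans symD)
qed

lemma hdist_le: "(u, v) \<in> adjacency H ^^ n \<Longrightarrow> hdist H u v \<le> n"
  unfolding hdist_def by (rule Least_le)

lemma hconnected_relpow_hdist:
  assumes "hconnected H" "u \<in> verts H" "v \<in> verts H"
  shows "(u, v) \<in> adjacency H ^^ hdist H u v"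
proof -
  obtain vs es where "hpath H vs es" "u \<in> set vs" "v \<in> set vs"
    using assms unfolding hconnected_def by blast
  then have "(u, v) \<in> (adjacency H)\<^sup>*"
    by (rule hpath_imp_rtrancl_adjacency)
  then show ?thesis
    unfolding hdist_def by (rule LeastI_ex[OF rtrancl_imp_relpow])
qed

lemma hconnected_obtains_parents:
  assumes H: "multi_kgraph k H" "k > 0" and con: "hconnected H" and u: "u \<in> verts H"
  obtains p where "\<And>e. e \<in># edges H \<Longrightarrow> p e \<in> e" "\<And>e. e \<in># edges H \<Longrightarrow> u \<in> e \<Longrightarrow> p e = u"
    "\<And>v. v \<in> verts H - {u} \<Longrightarrow> \<exists>e. e \<in># edges H \<and> v \<in> e - {p e}"
proof -
  note multiD = multi_kgraphD[OF H(1)]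
  define p where "p e = arg_min_on (hdist H u) e" for e
  have p: "p e \<in> e" "\<And>v. v \<in> e \<Longrightarrow> hdist H u (p e) \<le> hdist H u v" if "e \<in># edges H" for e
  proof -
    have "finite e" "e \<noteq> {}"
      using multiD(4,5)[OF that] H(2) by auto
    then show "p e \<in> e" "\<And>v. v \<in> e \<Longrightarrow> hdist H u (p e) \<le> hdist H u v"
      unfolding p_def by (auto intro: arg_min_if_finite arg_min_least)
  qed
  have p_root: "p e = u" if e: "e \<in># edges H" "u \<in> e" for e
  proof -
    have "hdist H u u = 0" using hdist_le[of u u 0 H] by simp
    then have "hdist H u (p e) = 0" using p(2)[OF e] by simp
    then show ?thesis
      using hconnected_relpow_hdist[OF con u, of "p e"] p(1)[OF e(1)] multiD(3)[OF e(1)] by auto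
  qed
  have p_cover: "\<exists>e. e \<in># edges H \<and> v \<in> e - {p e}" if v: "v \<in> verts H - {u}" for v
  proof (cases "hdist H u v")
    case 0
    then show ?thesis using hconnected_relpow_hdist[OF con u, of v] v by auto
  next
    case (Suc n)
    then obtain w where w: "(u, w) \<in> adjacency H ^^ n" "(w, v) \<in> adjacency H"
      using hconnected_relpow_hdist[OF con u, of v] v by auto
    then obtain e where e: "e \<in># edges H" "w \<in> e" "v \<in> e"
      by (auto simp: adjacency_def)
    have "hdist H u (p e) \<le> n"
      using p(2)[OF e(1,2)] hdist_le[OF w(1)] by simp
    then have "v \<noteq> p e" using Suc by auto
    with e show ?thesis by auto
  qed
  show ?thesis
    using p(1) p_root p_cover by (rule that)
qed

text \<open>The parent \<open>p e\<close> is the vertex that \<open>u\<close> replaces when the edge \<open>e\<close> is moved.\<close>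

locale rooted_kgraph =
  fixes k :: nat and H :: "'a hgraph" and y :: "'a \<Rightarrow> real" and u :: 'a and p :: "'a set \<Rightarrow> 'a"
  assumes H: "kgraph k H" and k: "k \<ge> 3" and u: "u \<in> verts H"
    and y_nonneg: "y v \<ge> 0" and y_max: "v \<in> verts H \<Longrightarrow> y v \<le> y u"
    and parent_in: "e \<in># edges H \<Longrightarrow> p e \<in> e"
    and parent_root: "e \<in># edges H \<Longrightarrow> u \<in> e \<Longrightarrow> p e = u"
    and parent_cover: "v \<in> verts H - {u} \<Longrightarrow> \<exists>e. e \<in># edges H \<and> v \<in> e - {p e}"
begin

abbreviation E :: "'a set set" where "E \<equiv> set_mset (edges H)"

definition children :: "'a set \<Rightarrow> 'a set" where "children e = e - {p e}"

definition parent_edges :: "'a \<Rightarrow> 'a set set" where "parent_edges v = {e \<in> E. v \<in> children e}"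

text \<open>If all edges are moved and the labels at \<open>v\<close> are \<open>1 / card (parent_edges v)\<close>, then the label of
  \<open>e\<close> at the root is \<open>weight e / t\<close>.\<close>

definition weight :: "'a set \<Rightarrow> real" where "weight e = (\<Prod>v\<in>children e. real (card (parent_edges v)))"

lemma multi: "multi_kgraph k H"
  using H by (simp add: kgraph_def)

lemmas finite_verts = multi_kgraphD(1)[OF multi]
  and edge_subset = multi_kgraphD(3)[OF multi]
  and card_edge = multi_kgraphD(4)[OF multi]
  and finite_edge = multi_kgraphD(5)[OF multi]

lemma parent_edges_subset: "parent_edges v \<subseteq> E"
  by (auto simp: parent_edges_def)

lemma finite_parent_edges [simp]: "finite (parent_edges v)"
  by (simp add: parent_edges_def)

lemma children_subset: "e \<in># edges H \<Longrightarrow> children e \<subseteq> verts H - {u}"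
  using edge_subset parent_root by (auto simp: children_def)

lemma finite_children: "e \<in># edges H \<Longrightarrow> finite (children e)"
  using finite_edge by (simp add: children_def)

lemma card_children: "e \<in># edges H \<Longrightarrow> card (children e) = k - 1"
  using parent_in card_edge finite_edge by (simp add: children_def)

lemma card_parent_edges_pos: "v \<in> verts H - {u} \<Longrightarrow> card (parent_edges v) > 0"
  using parent_cover[of v] by (auto simp: card_gt_0_iff parent_edges_def children_def)

lemma weight_pos: "e \<in># edges H \<Longrightarrow> weight e > 0"
  unfolding weight_def using children_subset card_parent_edges_pos by (intro prod_pos) auto

lemma weight_eq_prod_Int:
  assumes e: "e \<in># edges H" and one: "\<And>x. x \<in> verts H - {u} - S \<Longrightarrow> card (parent_edges x) = 1"
  shows "weight e = (\<Prod>v\<in>children e \<inter> S. real (card (parent_edges v)))"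
  unfolding weight_def using finite_children[OF e] children_subset[OF e] one
  by (intro prod.mono_neutral_right) auto

lemma sum_card_parent_edges: "(\<Sum>v\<in>verts H - {u}. card (parent_edges v)) = card E * (k - 1)"
proof -
  have "card {v \<in> verts H - {u}. v \<in> children e} = k - 1" if "e \<in># edges H" for e
  proof -
    have "{v \<in> verts H - {u}. v \<in> children e} = children e"
      using children_subset[OF that] by blast
    then show ?thesis
      using card_children[OF that] by simp
  qed
  then show ?thesis
    unfolding parent_edges_def using finite_verts by (subst sum_multicount[where k = "k - 1"]) auto
qed

definition move_except :: "'a set set \<Rightarrow> 'a set \<Rightarrow> 'a set" where
  "move_except K e = (if e \<in> K then e else insert u (children e))"

lemma edge_family_move_except: "edge_family k (verts H) E (move_except K)"
proof
  fix e assume e: "e \<in># edges H"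
  show "move_except K e \<subseteq> verts H"
    using edge_subset[OF e] u by (auto simp: move_except_def children_def)
  have "u \<notin> children e"
    using children_subset[OF e] by blast
  then show "card (move_except K e) = k"
    using k finite_children[OF e] card_children[OF e] card_edge[OF e] by (simp add: move_except_def)
qed (use finite_verts k in auto)

lemma prod_move_except_le:
  assumes e: "e \<in># edges H"
  shows "prod y e \<le> prod y (move_except K e)"
proof -
  have "u \<notin> children e"
    using children_subset[OF e] by blast
  have "prod y e = y (p e) * prod y (children e)"
    using finite_edge[OF e] parent_in[OF e] by (simp add: children_def prod.remove)
  also have "\<dots> \<le> y u * prod y (children e)"
    using y_nonneg y_max parent_in[OF e] edge_subset[OF e] by (intro mult_right_mono prod_nonneg) auto
  also have "\<dots> = prod y (insert u (children e))"
    using finite_children[OF e] \<open>u \<notin> children e\<close> by simp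
  finally show ?thesis
    by (simp add: move_except_def)
qed

text \<open>The vertex \<open>w\<close> spends \<open>weight e / t\<close> on each kept edge \<open>e\<close>, which makes the product of the labels
  of \<open>e\<close> equal to \<open>1 / t\<close>, and divides the rest equally among its parent edges.\<close>

definition kept_edge_label :: "real \<Rightarrow> 'a set set \<Rightarrow> 'a \<Rightarrow> 'a \<Rightarrow> 'a set \<Rightarrow> real" where
  "kept_edge_label t K w v e =
     (if v = w then if e \<in> K then weight e / t else (1 - sum weight K / t) / card (parent_edges w)
      else 1 / card (parent_edges v))"

lemma prod_kept_edge_label_children:
  assumes "e \<in># edges H" "e \<notin> K \<or> w \<notin> children e"
  shows "(\<Prod>v\<in>children e. kept_edge_label t K w v e)
    = (if w \<in> children e then 1 - sum weight K / t else 1) / weight e"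
proof -
  have "(\<Prod>v\<in>children e. kept_edge_label t K w v e)
      = (\<Prod>v\<in>children e. (if v = w then 1 - sum weight K / t else 1) * (1 / card (parent_edges v)))"
    using assms(2) by (intro prod.cong) (auto simp: kept_edge_label_def)
  also have "\<dots> = (if w \<in> children e then 1 - sum weight K / t else 1)
      * (\<Prod>v\<in>children e. 1 / card (parent_edges v))"
    using finite_children[OF assms(1)] by (simp only: prod.distrib prod.delta)
  finally show ?thesis
    by (simp add: weight_def prod_dividef)
qed

context
  fixes t :: real and K :: "'a set set" and w :: 'a
  assumes K: "K \<subseteq> E" and hanging: "\<And>e. e \<in> K \<Longrightarrow> u \<notin> e \<and> p e = w"
    and w: "w \<in> verts H - {u}" and weight_less: "sum weight K < t"
begin

lemma finite_kept: "finite K"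
  using K by (rule finite_subset) simp

lemma kept_weight_nonneg: "sum weight K \<ge> 0"
  using K weight_pos by (intro sum_nonneg) (auto simp: less_imp_le)

lemma incident_move_except:
  assumes "v \<in> verts H - {u}"
  shows "{e. e \<in># edges H \<and> v \<in> move_except K e} = (if v = w then K \<union> parent_edges w else parent_edges v)"
  using assms K hanging parent_in by (auto simp: move_except_def parent_edges_def children_def)

lemma kept_edge_label_pos:
  assumes "e \<in># edges H" "v \<in> verts H - {u}"
  shows "kept_edge_label t K w v e > 0"
  using weight_pos[OF assms(1)] card_parent_edges_pos[OF assms(2)] card_parent_edges_pos[OF w]
    kept_weight_nonneg weight_less by (auto simp: kept_edge_label_def)

lemma sum_kept_edge_label:
  assumes v: "v \<in> verts H - {u}"
  shows "(\<Sum>e | e \<in># edges H \<and> v \<in> move_except K e. kept_edge_label t K w v e) = 1"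
proof (cases "v = w")
  case True
  have disj: "K \<inter> parent_edges w = {}"
    using hanging by (auto simp: parent_edges_def children_def)
  have "(\<Sum>e\<in>K \<union> parent_edges w. kept_edge_label t K w w e)
      = (\<Sum>e\<in>K. kept_edge_label t K w w e) + (\<Sum>e\<in>parent_edges w. kept_edge_label t K w w e)"
    using finite_kept disj by (intro sum.union_disjoint) auto
  also have "(\<Sum>e\<in>K. kept_edge_label t K w w e) = sum weight K / t"
    by (simp add: kept_edge_label_def sum_divide_distrib)
  also have "(\<Sum>e\<in>parent_edges w. kept_edge_label t K w w e)
      = (\<Sum>e\<in>parent_edges w. (1 - sum weight K / t) / card (parent_edges w))"
    using disj by (intro sum.cong) (auto simp: kept_edge_label_def)
  also have "\<dots> = 1 - sum weight K / t"
    using card_parent_edges_pos[OF w] by (simp add: card_gt_0_iff)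
  finally show ?thesis
    unfolding incident_move_except[OF v] using True by simp
next
  case False
  then show ?thesis
    using card_parent_edges_pos[OF v]
    by (simp add: incident_move_except[OF v] kept_edge_label_def card_gt_0_iff)
qed

lemma prod_kept_edge_label_kept:
  assumes "e \<in> K"
  shows "t * (\<Prod>v\<in>e. kept_edge_label t K w v e) = 1"
proof -
  have e: "e \<in># edges H" "p e = w"
    using assms K hanging by auto
  have "w \<in> e" "w \<notin> children e"
    using parent_in[OF e(1)] e(2) by (auto simp: children_def)
  have "(\<Prod>v\<in>e. kept_edge_label t K w v e)
      = kept_edge_label t K w w e * (\<Prod>v\<in>children e. kept_edge_label t K w v e)"
    using finite_edge[OF e(1)] \<open>w \<in> e\<close> by (simp add: children_def e(2) prod.remove)
  also have "(\<Prod>v\<in>children e. kept_edge_label t K w v e) = 1 / weight e"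
    using \<open>w \<notin> children e\<close> by (simp add: prod_kept_edge_label_children[OF e(1)])
  also have "kept_edge_label t K w w e = weight e / t"
    using assms by (simp add: kept_edge_label_def)
  finally show ?thesis
    using weight_pos[OF e(1)] kept_weight_nonneg weight_less by simp
qed

lemma sum_root_labels:
  "(\<Sum>e | e \<in># edges H \<and> u \<in> move_except K e.
      1 / (\<Prod>v\<in>move_except K e - {u}. kept_edge_label t K w v e))
    = sum weight E - sum weight K + sum weight (parent_edges w) * (sum weight K / (t - sum weight K))"
proof -
  define D where "D = sum weight K"
  have t: "t > 0" "t - D > 0"
    using kept_weight_nonneg weight_less by (auto simp: D_def)
  have root_label: "1 / (\<Prod>v\<in>move_except K e - {u}. kept_edge_label t K w v e)
      = weight e + (if w \<in> children e then weight e * (D / (t - D)) else 0)" if "e \<in> E - K" for e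
  proof -
    have e: "e \<in># edges H" "e \<notin> K" using that by auto
    have "move_except K e - {u} = children e"
      using children_subset[OF e(1)] e(2) by (auto simp: move_except_def)
    then have "1 / (\<Prod>v\<in>move_except K e - {u}. kept_edge_label t K w v e)
        = weight e / (if w \<in> children e then 1 - D / t else 1)"
      using e by (simp add: prod_kept_edge_label_children D_def)
    also have "\<dots> = weight e + (if w \<in> children e then weight e * (D / (t - D)) else 0)"
      using t by (simp add: field_simps)
    finally show ?thesis .
  qed
  have "{e. e \<in># edges H \<and> u \<in> move_except K e} = E - K"
    using hanging by (auto simp: move_except_def)
  then have "(\<Sum>e | e \<in># edges H \<and> u \<in> move_except K e.
        1 / (\<Prod>v\<in>move_except K e - {u}. kept_edge_label t K w v e))
      = sum weight (E - K) + (\<Sum>e\<in>E - K. if w \<in> children e then weight e * (D / (t - D)) else 0)"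
    using root_label by (simp add: sum.distrib)
  also have "(\<Sum>e\<in>E - K. if w \<in> children e then weight e * (D / (t - D)) else 0)
      = (\<Sum>e\<in>parent_edges w. weight e * (D / (t - D)))"
    using hanging by (intro sum.mono_neutral_cong_right) (auto simp: parent_edges_def children_def)
  also have "\<dots> = sum weight (parent_edges w) * (D / (t - D))"
    by (simp only: sum_distrib_right)
  also have "sum weight (E - K) = sum weight E - D"
    using K by (simp add: sum_diff D_def)
  finally show ?thesis
    by (simp add: D_def)
qed

lemma subnormal_after_move_except:
  assumes less: "sum weight E - sum weight K
      + sum weight (parent_edges w) * (sum weight K / (t - sum weight K)) < t"
  shows "subnormal_after_move k H t y u"
proof -
  interpret edge_family k "verts H" E "move_except K"
    by (rule edge_family_move_except)
  have "rooted_subnormal t u (kept_edge_label t K w)"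
    unfolding rooted_subnormal_def sum_root_labels
  proof (intro conjI ballI impI less)
    fix e assume e: "e \<in># edges H"
    show "kept_edge_label t K w v e > 0" if "v \<in> move_except K e - {u}" for v
      using kept_edge_label_pos[OF e] edge_subset[OF e] that by blast
    assume "u \<notin> move_except K e"
    then have "e \<in> K" "move_except K e = e"
      by (auto simp: move_except_def split: if_splits)
    then show "1 \<le> t * (\<Prod>v\<in>move_except K e. kept_edge_label t K w v e)"
      using prod_kept_edge_label_kept by simp
  qed (simp add: sum_kept_edge_label)
  then show ?thesis
    unfolding subnormal_after_move_def
    using edge_family_move_except prod_move_except_le by blast
qed

end

end

section \<open>Bicyclic hypergraphs\<close>

lemma keep_one_edge_bound:
  fixes m t A D :: real
  assumes t: "t > 10" "m + 5 < t" "(t - m - 5) * (t - 1) = 9"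
    and cases: "D = 1 \<and> A < 9 \<or> D \<in> {3, 4} \<and> A \<le> 4"
  shows "m + 6 - D + A * (D / (t - D)) < t"
  using cases
proof (elim disjE conjE)
  assume D: "D = 1" and A: "A < 9"
  have "A * (D / (t - D)) < 9 / (t - 1)"
    using D A t(1) by (simp add: divide_strict_right_mono)
  also have "9 / (t - 1) = t - m - 5"
    using t by (simp add: field_simps)
  finally show ?thesis using D by simp
next
  assume D: "D \<in> {3, 4}" and A: "A \<le> 4"
  have "A * (D / (t - D)) \<le> 4 * (D / (t - D))"
    using D A t(1) by (intro mult_right_mono) auto
  also have "\<dots> < D - 1"
    using D t(1) by (auto simp: field_simps)
  finally show ?thesis using t(2) by simp
qed

lemma keep_pendent_edges_bound:
  fixes a b t :: real
  assumes t: "a + b + 8 < t" "(t - (a + b + 3) - 5) * (t - 1) = 9" and ab: "a > 1" "b > 1"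
  shows "a + b + 9 - b + 9 * (b / (t - b)) < t"
proof -
  define s where "s = t - (a + b + 8)"
  have s: "s > 0" "s * (t - 1) = 9" "t = s + a + b + 8"
    using t by (simp_all add: s_def algebra_simps)
  have "(b - 1) * 9 < (b - 1) * (t - b - s)"
    using ab s(3) by (intro mult_strict_left_mono) auto
  then have "9 * b < 9 + (b - 1) * (t - b - s)"
    by simp
  also have "\<dots> = (s + b - 1) * (t - b)"
    using s(2) by (simp add: algebra_simps)
  finally have "9 * (b / (t - b)) < s + b - 1"
    using ab s by (simp add: field_simps)
  then show ?thesis
    using s(3) by simp
qed

lemma sum_eq_card_plus_2_cases [consumes 3]:
  fixes d :: "'a \<Rightarrow> nat"
  assumes A: "finite A" and pos: "\<forall>x\<in>A. d x > 0" and sum: "sum d A = card A + 2"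
  obtains (triple) v where "v \<in> A" "d v = 3" "\<And>x. x \<in> A - {v} \<Longrightarrow> d x = 1"
  | (doubles) v w where "v \<in> A" "w \<in> A" "v \<noteq> w" "d v = 2" "d w = 2" "\<And>x. x \<in> A - {v, w} \<Longrightarrow> d x = 1"
proof -
  define g where "g x = d x - 1" for x
  have d: "d x = g x + 1" if "x \<in> A" for x
    using pos that by (simp add: g_def)
  then have "sum d A = sum g A + card A"
    by (simp add: sum_Suc)
  then have sum_g: "sum g A = 2" using sum by simp
  then obtain v where v: "v \<in> A" "g v \<noteq> 0"
    by (metis sum.neutral zero_neq_numeral)
  have rest_v: "g v + sum g (A - {v}) = 2"
    using sum_g sum.remove[OF A v(1), of g] by simp
  show ?thesis
  proof (cases "g v = 2")
    case True
    then have "g x = 0" if "x \<in> A - {v}" for x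
      using rest_v that A by simp
    then show ?thesis
      using True v d by (intro triple[of v]) auto
  next
    case False
    then have gv: "g v = 1" "sum g (A - {v}) = 1"
      using rest_v v by auto
    then obtain w where w: "w \<in> A - {v}" "g w \<noteq> 0"
      by (metis sum.neutral zero_neq_one)
    have "g w + sum g (A - {v} - {w}) = 1"
      using gv sum.remove[of "A - {v}" w g] A w by simp
    then have gw: "g w = 1" "sum g (A - {v} - {w}) = 0"
      using w by auto
    then have "g x = 0" if "x \<in> A - {v, w}" for x
      using that A by auto
    then show ?thesis
      using gw gv v w d by (intro doubles[of v w]) auto
  qed
qed

context rooted_kgraph
begin

lemma sum_weight_two_valued:
  fixes c :: real
  assumes "\<And>e. e \<in># edges H \<Longrightarrow> weight e = (if v \<in> children e then c else 1)"
  shows "sum weight E = card E + (c - 1) * card (parent_edges v)"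
proof -
  have "sum weight E = (\<Sum>e\<in>E. 1 + (if v \<in> children e then c - 1 else 0))"
    using assms by (intro sum.cong) auto
  also have "\<dots> = card E + (\<Sum>e\<in>parent_edges v. c - 1)"
    unfolding parent_edges_def by (simp only: sum.distrib sum.inter_filter finite_set_mset) simp
  finally show ?thesis by simp
qed

lemma sum_weight_parent_edges_le:
  fixes c :: real
  assumes "\<And>e. e \<in># edges H \<Longrightarrow> weight e \<le> c"
  shows "sum weight (parent_edges v) \<le> card (parent_edges v) * c"
  using assms parent_edges_subset by (intro sum_bounded_above) auto

lemma parent_nonroot:
  assumes "e \<in># edges H" "u \<notin> e"
  shows "p e \<in> verts H - {u}"
  using parent_in[OF assms(1)] edge_subset[OF assms(1)] assms(2) by auto

context
  fixes t :: real
  assumes many_edges: "card E \<ge> 5" and t: "real (card E) + 5 < t" "(t - real (card E) - 5) * (t - 1) = 9"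
begin

lemma subnormal_after_move_all_but_one:
  assumes total: "sum weight E = real (card E) + 6" and e: "e \<in># edges H" "u \<notin> e"
    and weights: "weight e = 1 \<and> sum weight (parent_edges (p e)) < 9
      \<or> weight e \<in> {3, 4} \<and> sum weight (parent_edges (p e)) \<le> 4"
  shows "subnormal_after_move k H t y u"
proof (rule subnormal_after_move_except[of "{e}" "p e"])
  have "t > 10"
    using many_edges t(1) by linarith
  then show "sum weight {e} < t"
    using weights by auto
  show "sum weight E - sum weight {e}
      + sum weight (parent_edges (p e)) * (sum weight {e} / (t - sum weight {e})) < t"
    using keep_one_edge_bound[OF \<open>t > 10\<close> t weights] total by simp
  show "p e \<in> verts H - {u}"
    by (rule parent_nonroot[OF e])
qed (use e in auto)

context
  fixes v :: 'a
  assumes v: "v \<in> verts H - {u}" "card (parent_edges v) = 3"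
    and one: "\<And>x. x \<in> verts H - {u} - {v} \<Longrightarrow> card (parent_edges x) = 1"
begin

lemma weight_triple:
  assumes "e \<in># edges H"
  shows "weight e = (if v \<in> children e then 3 else 1)"
  using weight_eq_prod_Int[OF assms, of "{v}"] one v(2) by simp

lemma sum_weight_triple: "sum weight E = real (card E) + 6"
  by (subst sum_weight_two_valued[OF weight_triple]) (simp_all add: v(2))

lemma subnormal_after_move_not_hanging:
  assumes e: "e \<in># edges H" "u \<notin> e" "p e \<noteq> v"
  shows "subnormal_after_move k H t y u"
proof (rule subnormal_after_move_all_but_one[OF sum_weight_triple e(1,2)])
  have "card (parent_edges (p e)) = 1"
    using one parent_nonroot[OF e(1,2)] e(3) by blast
  then have "sum weight (parent_edges (p e)) \<le> 3"
    using sum_weight_parent_edges_le[of 3 "p e"] weight_triple by simp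
  then show "weight e = 1 \<and> sum weight (parent_edges (p e)) < 9
      \<or> weight e \<in> {3, 4} \<and> sum weight (parent_edges (p e)) \<le> 4"
    using weight_triple[OF e(1)] by auto
qed

context
  assumes hanging: "\<And>e. e \<in># edges H \<Longrightarrow> u \<notin> e \<Longrightarrow> p e = v"
begin

lemma children_hanging: "e \<in># edges H \<Longrightarrow> children e = (if u \<in> e then e - {u} else e - {v})"
  using hanging parent_root by (auto simp: children_def)

lemma meets_hanging: "e \<in># edges H \<Longrightarrow> u \<in> e \<or> v \<in> e"
  using hanging parent_in by metis

lemma parent_edges_hanging:
  assumes "x \<noteq> u" "x \<noteq> v"
  shows "parent_edges x = edges_at H x"
  using assms children_hanging by (auto simp: parent_edges_def split: if_splits)

lemma parent_edges_triple_hanging: "parent_edges v = {e. e \<in># edges H \<and> u \<in> e \<and> v \<in> e}"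
  using v(1) children_hanging by (auto simp: parent_edges_def split: if_splits)

lemma card_edges_hanging:
  "card E = card (edges_avoiding H v) + card (edges_avoiding H u) + 3"
proof -
  let ?A = "edges_avoiding H v" and ?B = "edges_avoiding H u"
  have "E = ?A \<union> ?B \<union> parent_edges v"
    by (auto simp: parent_edges_triple_hanging)
  then have "card E = card (?A \<union> ?B \<union> parent_edges v)"
    by (rule arg_cong)
  also have "?A \<inter> ?B = {}" "(?A \<union> ?B) \<inter> parent_edges v = {}"
    using meets_hanging by (auto simp: parent_edges_triple_hanging)
  then have "card (?A \<union> ?B \<union> parent_edges v) = card ?A + card ?B + card (parent_edges v)"
    by (simp add: card_Un_disjoint)
  finally show ?thesis
    by (simp add: v(2))
qed

lemma hanging_iso_B2:
  "hgraph_iso H (B2 k (card (edges_avoiding H v)) (card (edges_avoiding H u)))"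
  "hgraph_iso H (B2 k (card (edges_avoiding H u)) (card (edges_avoiding H v)))"
proof -
  have deg: "card (edges_at H x) = 1" if "x \<in> verts H - {u, v}" for x
    using one[of x] parent_edges_hanging[of x] that by auto
  have both: "card {e. e \<in># edges H \<and> u \<in> e \<and> v \<in> e} = 3"
    using v(2) by (simp add: parent_edges_triple_hanging)
  show "hgraph_iso H (B2 k (card (edges_avoiding H v)) (card (edges_avoiding H u)))"
    using u v(1) deg meets_hanging both by (intro iso_B2[OF H k]) auto
  show "hgraph_iso H (B2 k (card (edges_avoiding H u)) (card (edges_avoiding H v)))"
    using u v(1) deg meets_hanging both by (intro iso_B2[OF H k]) (auto simp: conj_commute)
qed

lemma subnormal_after_move_two_pendents:
  assumes pendent: "card (edges_avoiding H v) > 1" "card (edges_avoiding H u) > 1"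
  shows "subnormal_after_move k H t y u"
proof (rule subnormal_after_move_except[of "edges_avoiding H u" v])
  let ?K = "edges_avoiding H u"
  define a where "a = real (card (edges_avoiding H v))"
  define b where "b = real (card ?K)"
  have card: "real (card E) = a + b + 3"
    by (simp add: card_edges_hanging a_def b_def)
  have ab: "a > 1" "b > 1"
    using pendent by (simp_all add: a_def b_def)
  have "weight e = 1" if "e \<in> ?K" for e
    using that by (simp add: weight_triple children_hanging)
  then have weight_kept: "sum weight ?K = b"
    by (simp add: b_def)
  show "sum weight ?K < t"
    using t(1) card ab weight_kept by simp
  have "weight e = 3" if "e \<in> parent_edges v" for e
    using that weight_triple by (simp add: parent_edges_def)
  then have "sum weight (parent_edges v) = 9"
    by (simp add: v(2))
  moreover have "a + b + 9 - b + 9 * (b / (t - b)) < t"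
    using t ab by (intro keep_pendent_edges_bound) (simp_all add: card)
  ultimately show "sum weight E - sum weight ?K
      + sum weight (parent_edges v) * (sum weight ?K / (t - sum weight ?K)) < t"
    by (simp add: sum_weight_triple weight_kept card)
qed (use v hanging in auto)

lemma subnormal_after_move_hanging:
  assumes not_iso: "\<not> hgraph_iso H (B2 k (card E - 4) 1)" "\<not> hgraph_iso H (B2 k (card E - 3) 0)"
  shows "subnormal_after_move k H t y u"
proof -
  define a where "a = card (edges_avoiding H v)"
  define b where "b = card (edges_avoiding H u)"
  have "hgraph_iso H (B2 k a b)" "hgraph_iso H (B2 k b a)"
    unfolding a_def b_def by (fact hanging_iso_B2)+
  moreover have "card E = a + b + 3"
    unfolding a_def b_def by (rule card_edges_hanging)
  ultimately have "a \<noteq> 0" "a \<noteq> 1" "b \<noteq> 0" "b \<noteq> 1"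
    using not_iso by (intro notI; simp)+
  then have "a > 1" "b > 1" by auto
  then show ?thesis
    unfolding a_def b_def by (rule subnormal_after_move_two_pendents)
qed

end

lemma subnormal_after_move_triple:
  assumes "\<not> hgraph_iso H (B2 k (card E - 4) 1)" "\<not> hgraph_iso H (B2 k (card E - 3) 0)"
  shows "subnormal_after_move k H t y u"
proof (cases "\<exists>e. e \<in># edges H \<and> u \<notin> e \<and> p e \<noteq> v")
  case True
  then show ?thesis
    using subnormal_after_move_not_hanging by blast
next
  case False
  then show ?thesis
    using assms by (intro subnormal_after_move_hanging) blast
qed

end

context
  fixes v w :: 'a
  assumes vw: "v \<in> verts H - {u}" "w \<in> verts H - {u}" "v \<noteq> w"
    and two: "card (parent_edges v) = 2" "card (parent_edges w) = 2"
    and one: "\<And>x. x \<in> verts H - {u} - {v, w} \<Longrightarrow> card (parent_edges x) = 1"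
begin

lemma weight_doubles:
  assumes "e \<in># edges H"
  shows "weight e = (if v \<in> children e then 2 else 1) * (if w \<in> children e then 2 else 1)"
  using weight_eq_prod_Int[OF assms, of "{v, w}"] one two vw(3) by simp

lemma sum_weight_doubles: "sum weight E = real (card E) + 4 + card (parent_edges v \<inter> parent_edges w)"
proof -
  have Int: "parent_edges v \<inter> parent_edges w = {e \<in> E. v \<in> children e \<and> w \<in> children e}"
    by (auto simp: parent_edges_def)
  have "sum weight E = (\<Sum>e\<in>E. 1 + (if v \<in> children e then 1 else 0) + (if w \<in> children e then 1 else 0)
      + (if v \<in> children e \<and> w \<in> children e then 1 else 0))"
    using weight_doubles by (intro sum.cong) auto
  also have "\<dots> = card E + card (parent_edges v) + card (parent_edges w)
      + card (parent_edges v \<inter> parent_edges w)"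
    unfolding Int by (simp add: sum.distrib parent_edges_def flip: sum.inter_filter)
  finally show ?thesis
    by (simp add: two)
qed

lemma subnormal_after_move_distinct_doubles:
  assumes distinct: "parent_edges v \<noteq> parent_edges w"
  shows "subnormal_after_move k H t y u"
proof (rule subnormal_after_move_except[of "{}" v])
  have "parent_edges v \<inter> parent_edges w \<subset> parent_edges v"
    using distinct two card_subset_eq[of "parent_edges w" "parent_edges v"] by auto
  then have "card (parent_edges v \<inter> parent_edges w) < 2"
    using psubset_card_mono[of "parent_edges v"] two(1) by simp
  then show "sum weight E - sum weight {}
      + sum weight (parent_edges v) * (sum weight {} / (t - sum weight {})) < t"
    using t(1) by (simp add: sum_weight_doubles)
qed (use vw t(1) in auto)

context
  assumes twins: "parent_edges v = parent_edges w"
begin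

lemma children_twins: "e \<in># edges H \<Longrightarrow> v \<in> children e \<longleftrightarrow> w \<in> children e"
  using twins by (auto simp: parent_edges_def)

lemma weight_twins: "e \<in># edges H \<Longrightarrow> weight e = (if v \<in> children e then 4 else 1)"
  using weight_doubles children_twins by auto

lemma sum_weight_twins: "sum weight E = real (card E) + 6"
  by (subst sum_weight_two_valued[OF weight_twins]) (simp_all add: two)

lemma subnormal_after_move_twins:
  assumes e: "e \<in># edges H" "u \<notin> e"
  shows "subnormal_after_move k H t y u"
proof (rule subnormal_after_move_all_but_one[OF sum_weight_twins e])
  have le: "sum weight (parent_edges (p e)) \<le> card (parent_edges (p e)) * 4"
    using sum_weight_parent_edges_le[of 4 "p e"] weight_twins by simp
  have parent: "p e \<in> verts H - {u}"
    by (rule parent_nonroot[OF e])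
  show "weight e = 1 \<and> sum weight (parent_edges (p e)) < 9
      \<or> weight e \<in> {3, 4} \<and> sum weight (parent_edges (p e)) \<le> 4"
  proof (cases "v \<in> children e")
    case True
    then have "p e \<notin> {v, w}"
      using children_twins[OF e(1)] by (auto simp: children_def)
    then show ?thesis
      using True le one[of "p e"] parent weight_twins[OF e(1)] by simp
  next
    case False
    have "card (parent_edges (p e)) \<le> 2"
      using one[of "p e"] parent two by (cases "p e \<in> {v, w}") auto
    then have "sum weight (parent_edges (p e)) < 9"
      using le by linarith
    then show ?thesis
      using False weight_twins[OF e(1)] by simp
  qed
qed

lemma twins_iso_B31:
  assumes root: "\<And>e. e \<in># edges H \<Longrightarrow> u \<in> e"
  shows "hgraph_iso H (B31 k (card E - 2) 0 0)"
proof -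
  have parent_edges: "parent_edges x = edges_at H x" if "x \<noteq> u" for x
    using root parent_root that by (auto simp: parent_edges_def children_def)
  have both: "card (edges_at H v) = 2"
    using two(1) parent_edges[of v] vw(1) by simp
  have "edges_avoiding H v = E - edges_at H v"
    by auto
  then have "card (edges_avoiding H v) = card E - 2"
    using both by (simp add: card_Diff_subset Collect_conj_eq)
  moreover have "v \<in> e \<longleftrightarrow> w \<in> e" if "e \<in># edges H" for e
    using twins parent_edges[of v] parent_edges[of w] vw that by blast
  moreover have "card (edges_at H x) = 1" if "x \<in> verts H - {u, v, w}" for x
    using one[of x] parent_edges[of x] that by auto
  ultimately show ?thesis
    using iso_B31[OF H k u _ _ _ _ vw(3) _ root _ both] vw by auto
qed

end

lemma subnormal_after_move_doubles:
  assumes "\<not> hgraph_iso H (B31 k (card E - 2) 0 0)"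
  shows "subnormal_after_move k H t y u"
proof (cases "parent_edges v = parent_edges w")
  case True
  then obtain e where "e \<in># edges H" "u \<notin> e"
    using twins_iso_B31 assms by blast
  then show ?thesis
    by (rule subnormal_after_move_twins[OF True])
next
  case False
  then show ?thesis
    by (rule subnormal_after_move_distinct_doubles)
qed

end

lemma subnormal_after_move_bicyclic:
  assumes bicyclic: "card (verts H) + 1 = card E * (k - 1)"
    and not_iso: "\<not> hgraph_iso H (B2 k (card E - 4) 1)" "\<not> hgraph_iso H (B2 k (card E - 3) 0)"
      "\<not> hgraph_iso H (B31 k (card E - 2) 0 0)"
  shows "subnormal_after_move k H t y u"
proof -
  have fin: "finite (verts H - {u})" and pos: "\<forall>v\<in>verts H - {u}. card (parent_edges v) > 0"
    using finite_verts card_parent_edges_pos by simp_all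
  have "card (verts H - {u}) + 2 = card E * (k - 1)"
    using bicyclic card.remove[OF finite_verts u] by linarith
  then have sum: "(\<Sum>v\<in>verts H - {u}. card (parent_edges v)) = card (verts H - {u}) + 2"
    by (simp add: sum_card_parent_edges)
  from fin pos sum show ?thesis
  proof (cases rule: sum_eq_card_plus_2_cases)
    case (triple v)
    then show ?thesis
      using not_iso(1,2) by (intro subnormal_after_move_triple[where v = v]) blast+
  next
    case (doubles v w)
    then show ?thesis
      using not_iso(3) by (intro subnormal_after_move_doubles[where v = v and w = w]) blast+
  qed
qed

end

end

lemma rho_less_root_bicyclic:
  assumes k: "k \<ge> 3" and m: "m \<ge> 5" and H: "H \<in> bicyclic_kgraphs k m"
    and t: "real m + 5 < t" "(t - real m - 5) * (t - 1) = 9"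
    and not_iso: "\<not> hgraph_iso H (B2 k (m - 4) 1)" "\<not> hgraph_iso H (B2 k (m - 3) 0)"
      "\<not> hgraph_iso H (B31 k (m - 2) 0 0)"
  shows "rho k H < root k t"
proof (rule rho_less_root)
  have con: "hconnected H" and size: "size (edges H) = m" and bi: "card (verts H) + 1 = m * (k - 1)"
    using H by (auto simp: bicyclic_kgraphs_def bicyclic_def)
  show kgraph: "kgraph k H" and "k \<ge> 3" and "t > 0"
    using assms by (auto simp: bicyclic_kgraphs_def)
  have card: "card (set_mset (edges H)) = m"
    using size arg_cong[OF kgraph_edges_eq_mset_set[OF kgraph], of size] by simp
  fix y :: "'a \<Rightarrow> real" and u
  assume y: "\<And>v. y v \<ge> 0" and u: "u \<in> verts H" and max: "\<And>v. v \<in> verts H \<Longrightarrow> y v \<le> y u"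
  obtain p where "\<And>e. e \<in># edges H \<Longrightarrow> p e \<in> e" "\<And>e. e \<in># edges H \<Longrightarrow> u \<in> e \<Longrightarrow> p e = u"
    "\<And>v. v \<in> verts H - {u} \<Longrightarrow> \<exists>e. e \<in># edges H \<and> v \<in> e - {p e}"
    using kgraph k by (elim hconnected_obtains_parents[OF _ _ con u, rotated 2]) (auto simp: kgraph_def)
  then interpret rooted_kgraph k H y u p
    using kgraph k u y max by unfold_locales auto
  show "subnormal_after_move k H t y u"
    using bi m t not_iso by (intro subnormal_after_move_bicyclic) (auto simp: card)
qed

lemma extremal_equation_obtains_root:
  assumes "m > (4 :: real)"
  obtains t where "m + 5 < t" "t < m + 6" "(t - m - 5) * (t - 1) = 9"
proof -
  have "continuous_on {m + 5..m + 6} (\<lambda>t. (t - m - 5) * (t - 1))"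
    by (intro continuous_intros)
  then obtain t where t: "m + 5 \<le> t" "t \<le> m + 6" "(t - m - 5) * (t - 1) = 9"
    using assms IVT'[of "\<lambda>t. (t - m - 5) * (t - 1)" "m + 5" 9 "m + 6"] by auto
  moreover have "t \<noteq> m + 5" "t \<noteq> m + 6"
    using t(3) assms by auto
  ultimately show ?thesis
    by (intro that[of t]) auto
qed

theorem theorem4p6:
  fixes k m :: nat and H :: "'a hgraph"
  assumes "k \<ge> 3" and "m \<ge> 5" and "H \<in> bicyclic_kgraphs k m"
  shows "(rho k (B2 k (m - 4) 1) < rho k (B2 k (m - 3) 0) \<and>
          rho k (B2 k (m - 3) 0) = rho k (B31 k (m - 2) 0 0)) \<and>
         (\<not> hgraph_iso H (B2 k (m - 4) 1) \<and> \<not> hgraph_iso H (B2 k (m - 3) 0) \<and>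
          \<not> hgraph_iso H (B31 k (m - 2) 0 0) \<longrightarrow>
          rho k H < rho k (B2 k (m - 4) 1))"
proof -
  obtain t where t: "real m + 5 < t" "t < real m + 6" "(t - real m - 5) * (t - 1) = 9"
    using extremal_equation_obtains_root[of m] assms(2) by auto
  have "rho k (B2 k (m - 4) 1) = root k t"
    using t assms(2) by (intro rho_B2[OF assms(1)]) (auto simp: of_nat_diff field_simps)
  moreover have "rho k (B2 k (m - 3) 0) = root k (real m + 6)"
    using assms(2) by (intro rho_B2[OF assms(1)]) (auto simp: of_nat_diff)
  moreover have "rho k (B31 k (m - 2) 0 0) = root k (real m + 6)"
    using assms(2) by (simp add: rho_B31[OF assms(1)] of_nat_diff add.commute)
  moreover have "root k t < root k (real m + 6)"
    using t(2) assms(1) by simp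
  ultimately show ?thesis
    using rho_less_root_bicyclic[OF assms t(1,3)] by auto
qed

end
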